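(* For every integer $n\ge1$, \[ r_{16}(n)=(-1)^{n}\frac{32}{17}\left(256\sum_{j=0}^{n-1}\sigma^{*}_{3}(j)\,\delta_{8}(n-j-1)-\sigma^{*}_{7}(n)\right). \]
   Context: For $s\ge1$ and $n\ge0$, $r_s(n)$ is the number of $(m_1,\dots,m_s)\in\mathbb{Z}^s$ with $m_1^2+\cdots+m_s^2=n$. For $n\ge0$, $\delta_8(n)$ is the number of representations of $n$ as a sum of $8$ triangular numbers, i.e. the number of $(t_1,\dots,t_8)\in\mathbb{Z}_{\ge0}^8$ with $\sum_i t_i(t_i+1)/2=n$. For $n,s\ge1$, $\sigma^{*}_{s}(n)=-\sum_{d\mid n}(-1)^{d}d^{s}$; by convention $\sigma_3^*(0)=-\frac1{16}$. *)

theory Defs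
  imports Complex_Main
begin

definition square_reps :: "nat \<Rightarrow> nat \<Rightarrow> int list set" where
  "square_reps s n = {m. length m = s \<and> (\<Sum>x\<leftarrow>m. x\<^sup>2) = int n}"

definition r_squares :: "nat \<Rightarrow> nat \<Rightarrow> nat" where
  "r_squares s n = card (square_reps s n)"

definition triangular_reps :: "nat \<Rightarrow> nat \<Rightarrow> nat list set" where
  "triangular_reps k n = {t. length t = k \<and> (\<Sum>x\<leftarrow>t. x * (x + 1) div 2) = n}"

definition delta8 :: "nat \<Rightarrow> nat" where
  "delta8 n = card (triangular_reps 8 n)"

text \<open>Meaningful for \<open>n \<ge> 1\<close> only: at \<open>n = 0\<close> the set of divisors is infinite.\<close>

definition sigma_star :: "nat \<Rightarrow> nat \<Rightarrow> int" where
  "sigma_star s n = - (\<Sum>d | d dvd n. (-1) ^ d * int d ^ s)"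

text \<open>The function \<open>sigma_star 3\<close> extended by the conventional value at \<open>0\<close>.\<close>

definition sigma3_star :: "nat \<Rightarrow> real" where
  "sigma3_star n = (if n = 0 then - 1 / 16 else of_int (sigma_star 3 n))"

lemma finite_square_reps: "finite (square_reps s n)"
proof (rule finite_subset)
  show "square_reps s n \<subseteq> {m. set m \<subseteq> {- int n..int n} \<and> length m = s}"
  proof
    fix m assume m: "m \<in> square_reps s n"
    have "x \<in> {- int n..int n}" if "x \<in> set m" for x
    proof -
      have "x\<^sup>2 \<le> (\<Sum>y\<leftarrow>m. y\<^sup>2)"
        using that by (intro member_le_sum_list) auto
      then have "\<bar>x\<bar>\<^sup>2 \<le> int n" using m by (simp add: square_reps_def)
      moreover have "\<bar>x\<bar> \<le> \<bar>x\<bar>\<^sup>2"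
        using self_le_power[of "\<bar>x\<bar>" 2] by (cases "x = 0") auto
      ultimately show ?thesis by auto
    qed
    then show "m \<in> {m. set m \<subseteq> {- int n..int n} \<and> length m = s}"
      using m by (auto simp: square_reps_def)
  qed
qed (simp add: finite_lists_length_eq)

lemma finite_triangular_reps: "finite (triangular_reps k n)"
proof (rule finite_subset)
  show "triangular_reps k n \<subseteq> {t. set t \<subseteq> {..n} \<and> length t = k}"
  proof
    fix t assume t: "t \<in> triangular_reps k n"
    have "x \<in> {..n}" if "x \<in> set t" for x
    proof -
      have "x * (x + 1) div 2 \<le> (\<Sum>y\<leftarrow>t. y * (y + 1) div 2)"
        using that by (intro member_le_sum_list) auto
      then have "x * (x + 1) div 2 \<le> n" using t by (simp add: triangular_reps_def)
      moreover have "x \<le> x * (x + 1) div 2"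
        by (cases x) auto
      ultimately show ?thesis by auto
    qed
    then show "t \<in> {t. set t \<subseteq> {..n} \<and> length t = k}"
      using t by (auto simp: triangular_reps_def)
  qed
qed (simp add: finite_lists_length_eq)

end

theory Submission
  imports Defs "HOL-Computational_Algebra.Formal_Power_Series"
begin

text \<open>
  In terms of generating functions the claim is
  \<open>17 + 32 \<Sum>\<^sub>n \<Sum>\<^sub>d\<^sub>|\<^sub>n (-1)\<^sup>d d\<^sup>7 q\<^sup>n = 17 \<phi>(-q)\<^sup>1\<^sup>6 + 512 \<phi>(-q)\<^sup>8 q \<psi>(q)\<^sup>8\<close>.
  Let \<open>e\<close>, \<open>a\<close>, \<open>b\<close> be the level 2 Eisenstein series of weights 2, 4, 6 and \<open>V\<close> the logarithmic
  derivative of \<open>q \<psi>(q)\<^sup>8\<close>. With \<open>D = q d/dq\<close>, four convolution identities hold: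
  \<open>2 D e = e V - a\<close>, \<open>D a = a V - b\<close>, \<open>e a = b\<close>, and the left-hand side above is \<open>9 a\<^sup>2 + 8 e b\<close>.
  Each follows by Skoruppa's argument: if \<open>F(k,l) = F(l,k) = F(k,k-l)\<close>, the bijection
  \<open>(k,l,x,y) \<mapsto> (k-l,l,x,x+y)\<close> on the positive solutions of \<open>k x + l y = n\<close> (from \<open>k > l\<close> to \<open>y > x\<close>)
  reduces the sum of \<open>F(k,l) - F(k+l,l)\<close> to the diagonals \<open>k = l\<close> and \<open>x = y\<close>, that is, to divisor sums.
  Gauss' products for \<open>\<phi>(-q)\<close> and \<open>\<psi>(q)\<close> show that \<open>\<phi>(-q)\<^sup>8\<close> and \<open>q \<psi>(q)\<^sup>8\<close> have the same
  logarithmic derivatives as \<open>a\<close> and \<open>e\<^sup>2 - a\<close>, so \<open>a = \<phi>(-q)\<^sup>8\<close> and \<open>e\<^sup>2 - a = 64 q \<psi>(q)\<^sup>8\<close>.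
\<close>

unbundle fps_syntax

subsection \<open>Sums over the solutions of \<open>a x + b y = n\<close>\<close>

definition quads :: "nat \<Rightarrow> (nat \<times> nat \<times> nat \<times> nat) set" where
  "quads n = {(a, b, x, y). 0 < a \<and> 0 < b \<and> 0 < x \<and> 0 < y \<and> a * x + b * y = n}"

lemma finite_quads [simp]: "finite (quads n)"
proof (rule finite_subset)
  show "quads n \<subseteq> {..n} \<times> {..n} \<times> {..n} \<times> {..n}"
  proof
    fix t assume "t \<in> quads n"
    then obtain a b x y where t: "t = (a, b, x, y)" and pos: "0 < a" "0 < b" "0 < x" "0 < y"
      and n: "a * x + b * y = n"
      by (auto simp: quads_def)
    have "a \<le> a * x" "x \<le> a * x" "b \<le> b * y" "y \<le> b * y" using pos by simp_all
    then have "a \<le> n" "x \<le> n" "b \<le> n" "y \<le> n" using n by linarith+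
    then show "t \<in> {..n} \<times> {..n} \<times> {..n} \<times> {..n}" using t by simp
  qed
qed simp

lemma sum_quads_swap:
  "(\<Sum>(a, b, x, y)\<in>{t \<in> quads n. P t}. f a b x y) =
   (\<Sum>(a, b, x, y)\<in>{(a, b, x, y) \<in> quads n. P (b, a, y, x)}. f b a y x)"
  by (rule sum.reindex_bij_witness[where i = "\<lambda>(a, b, x, y). (b, a, y, x)"
        and j = "\<lambda>(a, b, x, y). (b, a, y, x)"]) (auto simp: quads_def)

text \<open>Since \<open>a x + b y = (a - b) x + b (x + y)\<close>, subtracting \<open>b\<close>
  from \<open>a\<close> is compensated by adding \<open>x\<close> to \<open>y\<close>, and
  \<open>b < a\<close> turns into \<open>x < y\<close>.\<close>

lemma sum_quads_shear:
  "(\<Sum>(a, b, x, y)\<in>{(a, b, x, y) \<in> quads n. b < a}. f (int a) (int b)) =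
   (\<Sum>(a, b, x, y)\<in>{(a, b, x, y) \<in> quads n. x < y}. f (int a + int b) (int b))"
  by (rule sum.reindex_bij_witness[where i = "\<lambda>(a, b, x, y). (a + b, b, x, y - x)"
        and j = "\<lambda>(a, b, x, y). (a - b, b, x, x + y)"])
     (auto simp: quads_def algebra_simps dest!: less_imp_Suc_add)

lemma sum_quads_trichotomy:
  fixes f :: "nat \<times> nat \<times> nat \<times> nat \<Rightarrow> int" and u v :: "nat \<times> nat \<times> nat \<times> nat \<Rightarrow> nat"
  shows "(\<Sum>t\<in>quads n. f t) = (\<Sum>t\<in>{t \<in> quads n. u t = v t}. f t) +
    (\<Sum>t\<in>{t \<in> quads n. u t < v t}. f t) + (\<Sum>t\<in>{t \<in> quads n. v t < u t}. f t)"
proof -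
  have "quads n = ({t \<in> quads n. u t = v t} \<union> {t \<in> quads n. u t < v t}) \<union> {t \<in> quads n. v t < u t}"
    by auto
  then have "(\<Sum>t\<in>quads n. f t) =
    (\<Sum>t\<in>({t \<in> quads n. u t = v t} \<union> {t \<in> quads n. u t < v t}) \<union> {t \<in> quads n. v t < u t}. f t)"
    by simp
  also have "\<dots> = (\<Sum>t\<in>{t \<in> quads n. u t = v t} \<union> {t \<in> quads n. u t < v t}. f t)
      + (\<Sum>t\<in>{t \<in> quads n. v t < u t}. f t)"
    by (rule sum.union_disjoint) auto
  also have "(\<Sum>t\<in>{t \<in> quads n. u t = v t} \<union> {t \<in> quads n. u t < v t}. f t) =
      (\<Sum>t\<in>{t \<in> quads n. u t = v t}. f t) + (\<Sum>t\<in>{t \<in> quads n. u t < v t}. f t)"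
    by (rule sum.union_disjoint) auto
  finally show ?thesis .
qed

text \<open>If \<open>a = b = d\<close>, then \<open>x + y = n div d\<close>, which leaves
  \<open>n div d - 1\<close> choices of \<open>x\<close>.\<close>

lemma sum_quads_diag_left:
  assumes "n > 0"
  shows "(\<Sum>(a, b, x, y)\<in>{(a, b, x, y) \<in> quads n. a = b}. f (int a)) =
    (\<Sum>d | d dvd n. (int (n div d) - 1) * f (int d))"
proof -
  have "(\<Sum>(a, b, x, y)\<in>{(a, b, x, y) \<in> quads n. a = b}. f (int a)) =
    (\<Sum>(d, x)\<in>(SIGMA d:{d. d dvd n}. {1..<n div d}). f (int d))"
    by (rule sum.reindex_bij_witness[where i = "\<lambda>(d, x). (d, d, x, n div d - x)"
          and j = "\<lambda>(a, b, x, y). (a, x)"])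
       (use assms in \<open>auto simp: quads_def simp flip: distrib_left elim!: dvdE\<close>)
  also have "\<dots> = (\<Sum>d | d dvd n. \<Sum>x\<in>{1..<n div d}. f (int d))"
    by (rule sum.Sigma[symmetric]) (use assms in auto)
  also have "\<dots> = (\<Sum>d | d dvd n. (int (n div d) - 1) * f (int d))"
  proof (rule sum.cong)
    fix d assume "d \<in> {d. d dvd n}"
    then have "n div d \<ge> 1" using assms by (auto elim!: dvdE)
    then show "(\<Sum>x\<in>{1..<n div d}. f (int d)) = (int (n div d) - 1) * f (int d)"
      by (simp add: of_nat_diff)
  qed simp
  finally show ?thesis .
qed

text \<open>If \<open>x = y\<close>, then \<open>d = a + b\<close> divides \<open>n\<close>, and
  \<open>b\<close> runs through \<open>1..<d\<close>.\<close>

lemma sum_quads_diag_right: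
  assumes "n > 0"
  shows "(\<Sum>(a, b, x, y)\<in>{(a, b, x, y) \<in> quads n. x = y}. f (int a + int b) (int b)) =
    (\<Sum>d | d dvd n. \<Sum>b = 1..<d. f (int d) (int b))"
proof -
  have "(\<Sum>(a, b, x, y)\<in>{(a, b, x, y) \<in> quads n. x = y}. f (int a + int b) (int b)) =
    (\<Sum>(d, b)\<in>(SIGMA d:{d. d dvd n}. {1..<d}). f (int d) (int b))"
    by (rule sum.reindex_bij_witness[where i = "\<lambda>(d, b). (d - b, b, n div d, n div d)"
          and j = "\<lambda>(a, b, x, y). (a + b, b)"])
       (use assms in \<open>auto simp: quads_def simp flip: distrib_right elim!: dvdE\<close>)
  also have "\<dots> = (\<Sum>d | d dvd n. \<Sum>b\<in>{1..<d}. f (int d) (int b))"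
    by (rule sum.Sigma[symmetric]) (use assms in auto)
  finally show ?thesis .
qed

text \<open>The sum of \<open>F a b\<close> is split by the order of \<open>a\<close> and
  \<open>b\<close>, that of \<open>F (a + b) b\<close> by the order of \<open>x\<close> and
  \<open>y\<close>; the shear matches the off-diagonal parts. A condition on the symmetrisation of
  \<open>K\<close> suffices because swapping the two products permutes
  \<open>quads n\<close>.\<close>

lemma sum_quads_eq_divisor_sum:
  fixes F K :: "int \<Rightarrow> int \<Rightarrow> int"
  assumes "n > 0"
    and F_swap: "\<And>a b. F a b = F b a"
    and F_reflect: "\<And>a b. F a b = F a (a - b)"
    and K: "\<And>a b. K a b + K b a = 2 * (F a b - F (a + b) b)"
  shows "(\<Sum>(a, b, x, y)\<in>quads n. K (int a) (int b)) =
    (\<Sum>d | d dvd n. (int (n div d) - 1) * F (int d) (int d) - (\<Sum>b = 1..<d. F (int d) (int b)))"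
proof -
  let ?S = "\<lambda>f. \<Sum>(a, b, x, y)\<in>quads n. f (int a) (int b) :: int"
  let ?H = "\<lambda>a b. F (a + b) b"
  \<comment> \<open>With first argument \<open>a + b\<close>, the reflection exchanges
    \<open>b\<close> and \<open>a\<close>.\<close>
  have H_swap: "F (a + b) b = F (b + a) a" for a b
    using F_reflect[of "a + b" b] by (simp add: add.commute)
  have "?S F = (\<Sum>(a, b, x, y)\<in>{(a, b, x, y) \<in> quads n. a = b}. F (int a) (int b)) +
     (\<Sum>(a, b, x, y)\<in>{(a, b, x, y) \<in> quads n. a < b}. F (int a) (int b)) +
     (\<Sum>(a, b, x, y)\<in>{(a, b, x, y) \<in> quads n. b < a}. F (int a) (int b))"
    using sum_quads_trichotomy[of "\<lambda>(a, b, x, y). F (int a) (int b)" n "\<lambda>(a, b, x, y). a" "\<lambda>(a, b, x, y). b"]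
    by (simp add: case_prod_unfold)
  also have "(\<Sum>(a, b, x, y)\<in>{(a, b, x, y) \<in> quads n. a < b}. F (int a) (int b)) =
     (\<Sum>(a, b, x, y)\<in>{(a, b, x, y) \<in> quads n. b < a}. F (int a) (int b))"
    using sum_quads_swap[of "\<lambda>a b x y. F (int a) (int b)" n "\<lambda>(a, b, x, y). a < b"] F_swap
    by (simp add: case_prod_unfold)
  also have "(\<Sum>(a, b, x, y)\<in>{(a, b, x, y) \<in> quads n. a = b}. F (int a) (int b)) =
     (\<Sum>(a, b, x, y)\<in>{(a, b, x, y) \<in> quads n. a = b}. F (int a) (int a))"
    by (rule sum.cong) auto
  finally have 1: "?S F = (\<Sum>d | d dvd n. (int (n div d) - 1) * F (int d) (int d)) +
     2 * (\<Sum>(a, b, x, y)\<in>{(a, b, x, y) \<in> quads n. b < a}. F (int a) (int b))"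
    using sum_quads_diag_left[OF \<open>n > 0\<close>, of "\<lambda>a. F a a"] by linarith
  have "?S ?H = (\<Sum>(a, b, x, y)\<in>{(a, b, x, y) \<in> quads n. x = y}. ?H (int a) (int b)) +
     (\<Sum>(a, b, x, y)\<in>{(a, b, x, y) \<in> quads n. x < y}. ?H (int a) (int b)) +
     (\<Sum>(a, b, x, y)\<in>{(a, b, x, y) \<in> quads n. y < x}. ?H (int a) (int b))"
    using sum_quads_trichotomy[of "\<lambda>(a, b, x, y). ?H (int a) (int b)" n "\<lambda>(a, b, x, y). x" "\<lambda>(a, b, x, y). y"]
    by (simp add: case_prod_unfold)
  also have "(\<Sum>(a, b, x, y)\<in>{(a, b, x, y) \<in> quads n. y < x}. ?H (int a) (int b)) =
     (\<Sum>(a, b, x, y)\<in>{(a, b, x, y) \<in> quads n. x < y}. ?H (int a) (int b))"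
    using sum_quads_swap[of "\<lambda>a b x y. ?H (int a) (int b)" n "\<lambda>(a, b, x, y). y < x"] H_swap
    by (simp add: case_prod_unfold)
  \<comment> \<open>The shear turns the half \<open>x < y\<close> into the half \<open>b < a\<close>
    that occurs in \<open>1\<close>, so the two cancel in the difference.\<close>
  finally have 2: "?S ?H = (\<Sum>d | d dvd n. \<Sum>b = 1..<d. F (int d) (int b)) +
     2 * (\<Sum>(a, b, x, y)\<in>{(a, b, x, y) \<in> quads n. b < a}. F (int a) (int b))"
    using sum_quads_diag_right[OF \<open>n > 0\<close>, of F] sum_quads_shear[of F n] by linarith
  have "?S K = ?S (\<lambda>a b. K b a)"
    using sum_quads_swap[of "\<lambda>a b x y. K (int a) (int b)" n "\<lambda>_. True"] by (simp add: case_prod_unfold)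
  then have "2 * ?S K = ?S (\<lambda>a b. K a b + K b a)"
    by (simp add: sum.distrib case_prod_unfold)
  also have "\<dots> = 2 * (?S F - ?S ?H)"
    by (simp add: K case_prod_unfold sum_distrib_left sum_subtractf[symmetric])
  finally show ?thesis
    using 1 2 by (simp add: sum_subtractf)
qed

text \<open>A function on pairs that are not both even, invariant under \<open>(a, b) \<mapsto> (b, a)\<close> and
  \<open>(a, b) \<mapsto> (a, a - b)\<close>, is determined by its values \<open>p\<close> on (even, odd) pairs, because these two maps
  permute the three nonzero classes modulo 2 transitively.\<close>

definition parity_glue :: "(int \<Rightarrow> int \<Rightarrow> int) \<Rightarrow> (int \<Rightarrow> int \<Rightarrow> int) \<Rightarrow> int \<Rightarrow> int \<Rightarrow> int" where
  "parity_glue p z a b =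
    (if even a then if even b then z a b else p a b else if even b then p b a else p (a - b) a)"

text \<open>The conditions on \<open>K\<close> are those of \<open>sum_quads_eq_divisor_sum\<close>,
  one parity class at a time; (odd, even) follows from (even, odd) by symmetry.\<close>

lemma sum_quads_parity_glue:
  fixes p z K :: "int \<Rightarrow> int \<Rightarrow> int"
  assumes "n > 0"
    and p: "\<And>a b. p a b = p a (a - b)" "\<And>a b. p (- a) (- b) = p a b"
    and z: "\<And>a b. z a b = z a (a - b)" "\<And>a b. z a b = z b a"
    and K00: "\<And>a b. even a \<Longrightarrow> even b \<Longrightarrow> K a b + K b a = 2 * (z a b - z (a + b) b)"
    and K01: "\<And>a b. even a \<Longrightarrow> odd b \<Longrightarrow> K a b + K b a = 2 * (p a b - p a (a + b))"
    and K11: "\<And>a b. odd a \<Longrightarrow> odd b \<Longrightarrow> K a b + K b a = 2 * (p (a - b) a - p (a + b) b)"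
  shows "(\<Sum>(a, b, x, y)\<in>quads n. K (int a) (int b)) =
    (\<Sum>d | d dvd n. (int (n div d) - 1) * parity_glue p z (int d) (int d)
       - (\<Sum>b = 1..<d. parity_glue p z (int d) (int b)))"
proof (rule sum_quads_eq_divisor_sum[OF \<open>n > 0\<close>])
  fix a b
  \<comment> \<open>This is the symmetry of the glued function on pairs of odd numbers: reflect,
    then negate both arguments.\<close>
  have *: "p (a - b) a = p (b - a) b" for a b
    using p(1)[of "a - b" a] p(2)[of "a - b" "- b"] by simp
  show "parity_glue p z a b = parity_glue p z b a"
    using z(2)[of a b] *[of a b] by (auto simp: parity_glue_def)
  show "parity_glue p z a b = parity_glue p z a (a - b)"
    using z(1)[of a b] p(1)[of a b] *[of a b] by (auto simp: parity_glue_def)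
  have K10: "K a b + K b a = 2 * (p b a - p b (a + b))" if "odd a" "even b"
    using K01[OF that(2,1)] by (simp add: add.commute)
  show "K a b + K b a = 2 * (parity_glue p z a b - parity_glue p z (a + b) b)"
    using K00[of a b] K01[of a b] K10 K11[of a b] by (auto simp: parity_glue_def)
qed

text \<open>Terms are added in pairs because the glued function is given by different polynomials at
  even and at odd \<open>b\<close>.\<close>

lemma sum_lessThan_double:
  fixes f :: "int \<Rightarrow> int \<Rightarrow> int" and g :: "int \<Rightarrow> int \<Rightarrow> int"
  assumes "g d 0 = 0" and "\<And>k. g d (k + 1) = g d k + f d (2 * k) + f d (2 * k + 1)"
  shows "(\<Sum>b<2 * k. f d (int b)) = g d (int k)"
proof (induction k)
  case (Suc k)
  have "2 * Suc k = Suc (Suc (2 * k))" by simp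
  then show ?case using Suc assms(2)[of "int k"] by (simp add: add.commute)
qed (simp add: assms)

text \<open>The sum is extended to \<open>b = 0\<close>, and the extra term, \<open>p 0 d\<close> or
  \<open>z d 0\<close>, is added to \<open>R\<close>. For \<open>d = 2 * k + 1\<close> the last
  term, \<open>b = 2 * k\<close>, is left over from the pairing and enters separately.\<close>

lemma sum_parity_glue:
  fixes p z g h :: "int \<Rightarrow> int \<Rightarrow> int"
  assumes g: "\<And>d. g d 0 = 0" "\<And>d k. g d (k + 1) = g d k + p (2 * k) d + p (d - (2 * k + 1)) d"
    and h: "\<And>d. h d 0 = 0" "\<And>d k. h d (k + 1) = h d k + z d (2 * k) + p d (2 * k + 1)"
    and R: "\<And>k. g (2 * k + 1) k + p (2 * k) (2 * k + 1) = R (2 * k + 1) + p 0 (2 * k + 1)"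
      "\<And>k. h (2 * k) k = R (2 * k) + z (2 * k) 0"
    and "d > 0"
  shows "(\<Sum>b = 1..<d. parity_glue p z (int d) (int b)) = R (int d)"
proof -
  have *: "(\<Sum>b<d. parity_glue p z (int d) (int b)) =
      parity_glue p z (int d) 0 + (\<Sum>b = 1..<d. parity_glue p z (int d) (int b))"
    using \<open>d > 0\<close> by (simp add: lessThan_atLeast0 sum.atLeast_Suc_lessThan)
  show ?thesis
  proof (cases "even d")
    case True
    then obtain k where d: "d = 2 * k" by (elim evenE)
    have "(\<Sum>b<2 * k. parity_glue p z (int d) (int b)) = h (int d) (int k)"
      by (rule sum_lessThan_double) (use True h in \<open>simp_all add: parity_glue_def\<close>)
    then show ?thesis using * d R(2)[of "int k"] by (simp add: parity_glue_def)
  next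
    case False
    then obtain k where d: "d = 2 * k + 1" by (elim oddE)
    have "(\<Sum>b<2 * k. parity_glue p z (int d) (int b)) = g (int d) (int k)"
      by (rule sum_lessThan_double) (use False g in \<open>simp_all add: parity_glue_def\<close>)
    then show ?thesis using * d R(1)[of "int k"] by (simp add: parity_glue_def algebra_simps)
  qed
qed

text \<open>The functions \<open>g\<close> and \<open>h\<close> are the partial sums over \<open>b < 2 * k\<close> of the glued function at odd and at
  even \<open>d\<close>. In the applications the coefficients of \<open>p\<close> and \<open>z\<close> solve the linear system given by the
  three conditions on \<open>K\<close>.\<close>

lemma sum_quads_closed_form:
  fixes p z g h K :: "int \<Rightarrow> int \<Rightarrow> int" and Q T :: "int \<Rightarrow> int"
  assumes "n > 0"
    and p: "\<And>a b. p a b = p a (a - b)" "\<And>a b. p (- a) (- b) = p a b"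
    and z: "\<And>a b. z a b = z a (a - b)" "\<And>a b. z a b = z b a"
    and K: "\<And>a b. even a \<Longrightarrow> even b \<Longrightarrow> K a b + K b a = 2 * (z a b - z (a + b) b)"
      "\<And>a b. even a \<Longrightarrow> odd b \<Longrightarrow> K a b + K b a = 2 * (p a b - p a (a + b))"
      "\<And>a b. odd a \<Longrightarrow> odd b \<Longrightarrow> K a b + K b a = 2 * (p (a - b) a - p (a + b) b)"
    and Q: "\<And>d. even d \<Longrightarrow> z d d = d * Q d" "\<And>d. odd d \<Longrightarrow> p 0 d = d * Q d"
    and g: "\<And>d. g d 0 = 0" "\<And>d k. g d (k + 1) = g d k + p (2 * k) d + p (d - (2 * k + 1)) d"
    and h: "\<And>d. h d 0 = 0" "\<And>d k. h d (k + 1) = h d k + z d (2 * k) + p d (2 * k + 1)"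
    and T: "\<And>k. g (2 * k + 1) k + p (2 * k) (2 * k + 1) = T (2 * k + 1)"
      "\<And>k. h (2 * k) k + z (2 * k) (2 * k) = T (2 * k) + z (2 * k) 0"
  shows "(\<Sum>(a, b, x, y)\<in>quads n. K (int a) (int b)) =
    int n * (\<Sum>d | d dvd n. Q (int d)) - (\<Sum>d | d dvd n. T (int d))"
proof -
  have "(\<Sum>(a, b, x, y)\<in>quads n. K (int a) (int b)) =
    (\<Sum>d | d dvd n. (int (n div d) - 1) * parity_glue p z (int d) (int d)
       - (\<Sum>b = 1..<d. parity_glue p z (int d) (int b)))"
    by (rule sum_quads_parity_glue[OF \<open>n > 0\<close> p z K])
  also have "\<dots> = (\<Sum>d | d dvd n. int n * Q (int d) - T (int d))"
  proof (intro sum.cong refl)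
    fix d assume "d \<in> {d. d dvd n}"
    then obtain k where k: "n = d * k" by auto
    then have "d > 0" using \<open>n > 0\<close> by simp
    have diag: "parity_glue p z (int d) (int d) = int d * Q (int d)"
      using Q[of "int d"] by (auto simp: parity_glue_def)
    \<comment> \<open>As \<open>(n div d) * d = n\<close>, the weighted diagonal equals
      \<open>n * Q d - d * Q d\<close>; \<open>T\<close> collects \<open>d * Q d\<close> and the sum
      over \<open>b\<close>.\<close>
    have "(\<Sum>b = 1..<d. parity_glue p z (int d) (int b)) = T (int d) - int d * Q (int d)"
      using g h
    proof (rule sum_parity_glue)
      fix k :: int
      show "g (2 * k + 1) k + p (2 * k) (2 * k + 1) =
          T (2 * k + 1) - (2 * k + 1) * Q (2 * k + 1) + p 0 (2 * k + 1)"
        using T(1)[of k] Q(2)[of "2 * k + 1"] by simp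
      show "h (2 * k) k = T (2 * k) - 2 * k * Q (2 * k) + z (2 * k) 0"
        using T(2)[of k] Q(1)[of "2 * k"] by simp
    qed fact
    then show "(int (n div d) - 1) * parity_glue p z (int d) (int d)
       - (\<Sum>b = 1..<d. parity_glue p z (int d) (int b)) = int n * Q (int d) - T (int d)"
      using \<open>d > 0\<close> by (simp add: diag k algebra_simps)
  qed
  finally show ?thesis by (simp add: sum_subtractf sum_distrib_left)
qed

section \<open>Lambert series and their products\<close>

definition lambert :: "(int \<Rightarrow> int) \<Rightarrow> real fps" where
  "lambert f = Abs_fps (\<lambda>n. if n = 0 then 0 else real_of_int (\<Sum>d | d dvd n. f (int d)))"

lemma lambert_nth: "lambert f $ n = (if n = 0 then 0 else real_of_int (\<Sum>d | d dvd n. f (int d)))"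
  by (simp add: lambert_def)

text \<open>Divisors \<open>a\<close> of \<open>i\<close> and \<open>b\<close> of
  \<open>n - i\<close>, taken with their cofactors \<open>x\<close> and \<open>y\<close>, are
  exactly the solutions of \<open>a x + b y = n\<close>.\<close>

lemma lambert_mult_nth:
  "(lambert f * lambert g) $ n = real_of_int (\<Sum>(a, b, x, y)\<in>quads n. f (int a) * g (int b))"
proof -
  have "(lambert f * lambert g) $ n = (\<Sum>i=0..n. lambert f $ i * lambert g $ (n - i))"
    by (simp add: fps_mult_nth)
  also have "\<dots> = (\<Sum>i\<in>{1..<n}. lambert f $ i * lambert g $ (n - i))"
    by (rule sum.mono_neutral_right) (auto simp: lambert_nth)
  also have "\<dots> = (\<Sum>i\<in>{1..<n}. real_of_int (\<Sum>(a, b)\<in>{a. a dvd i} \<times> {b. b dvd n - i}. f (int a) * g (int b)))"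
    by (rule sum.cong) (auto simp: lambert_nth sum_product sum.cartesian_product case_prod_unfold)
  also have "\<dots> = real_of_int (\<Sum>i\<in>{1..<n}. \<Sum>(a, b)\<in>{a. a dvd i} \<times> {b. b dvd n - i}. f (int a) * g (int b))"
    by simp
  also have "(\<Sum>i\<in>{1..<n}. \<Sum>(a, b)\<in>{a. a dvd i} \<times> {b. b dvd n - i}. f (int a) * g (int b)) =
     (\<Sum>(i, a, b)\<in>(SIGMA i:{1..<n}. {a. a dvd i} \<times> {b. b dvd n - i}). f (int a) * g (int b))"
    by (subst sum.Sigma) (auto simp: case_prod_unfold)
  also have "\<dots> = (\<Sum>(a, b, x, y)\<in>quads n. f (int a) * g (int b))"
    by (rule sum.reindex_bij_witness[where j = "\<lambda>(i, a, b). (a, b, i div a, (n - i) div b)"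
          and i = "\<lambda>(a, b, x, y). (a * x, a, b)"])
       (auto simp: quads_def elim!: dvdE intro!: gr0I split: if_splits)
  finally show ?thesis .
qed

subsection \<open>Eisenstein series of level 2\<close>

lemma numeral_mult_fps_nth: "(numeral k * f) $ n = numeral k * (f $ n :: real)"
  by (simp add: numeral_fps_const)

lemma X_fps_deriv_nth: "(fps_X * fps_deriv f) $ n = of_nat n * (f $ n :: real)"
  by (cases n) simp_all

text \<open>This is \<open>(-1)^d d^k\<close>, with the sign as a case distinction since
  \<open>d\<close> is an integer.\<close>

definition alt_power :: "nat \<Rightarrow> int \<Rightarrow> int" where
  "alt_power k d = (if even d then d ^ k else - (d ^ k))"

definition odd_part :: "int \<Rightarrow> int" where
  "odd_part d = (if odd d then d else 0)"

text \<open>In terms of the classical series \<open>E_k(q)\<close>: \<open>eis2\<close> is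
  \<open>2 E_2(q^2) - E_2(q)\<close>, \<open>eis2_alt\<close> is
  \<open>(4 E_2(q^2) - E_2(q)) / 3\<close> and only quasimodular, \<open>eis4\<close> is
  \<open>(16 E_4(q^2) - E_4(q)) / 15\<close>, \<open>eis6\<close> is
  \<open>(64 E_6(q^2) - E_6(q)) / 63\<close>, and \<open>eis8\<close> is
  \<open>(256 E_8(q^2) - E_8(q)) / 15\<close>.\<close>

definition eis2 :: "real fps" where "eis2 = 1 + 24 * lambert odd_part"
definition eis2_alt :: "real fps" where "eis2_alt = 1 - 8 * lambert (alt_power 1)"
definition eis4 :: "real fps" where "eis4 = 1 + 16 * lambert (alt_power 3)"
definition eis6 :: "real fps" where "eis6 = 1 - 8 * lambert (alt_power 5)"
definition eis8 :: "real fps" where "eis8 = 17 + 32 * lambert (alt_power 7)"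

text \<open>A differential equation of Ramanujan's type. In degree \<open>n > 0\<close> it reads:
  sum of \<open>K\<close> equals \<open>n\<close> times the sum of \<open>Q\<close> minus the sum of
  \<open>T\<close>, where \<open>K\<close> comes from the product, \<open>Q\<close> from the
  derivative and \<open>T\<close> from the linear terms.\<close>

lemma deriv_eis2: "2 * (fps_X * fps_deriv eis2) = eis2 * eis2_alt - eis4"
proof (rule fps_ext)
  fix n :: nat
  define K :: "int \<Rightarrow> int \<Rightarrow> int" where "K a b = - 192 * (odd_part a * alt_power 1 b)" for a b
  \<comment> \<open>A quadratic polynomial in \<open>a\<close> and \<open>b\<close> built from
    \<open>a^2\<close> and \<open>b * (a - b)\<close>, both invariant under \<open>b\<close> to
    \<open>a - b\<close>. On even pairs \<open>odd_part\<close> makes \<open>K\<close> vanish, so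
    \<open>z = 0\<close> will do.\<close>
  define p :: "int \<Rightarrow> int \<Rightarrow> int" where "p a b = - 24 * a^2 - 48 * b * (a - b)" for a b
  define z :: "int \<Rightarrow> int \<Rightarrow> int" where "z a b = 0" for a b
  define g :: "int \<Rightarrow> int \<Rightarrow> int" where
    "g d k = 24 * d^2 * k + 48 * d * k^2 + 48 * d * k - 64 * k^3 + 48 * k^2 - 8 * k" for d k
  define h :: "int \<Rightarrow> int \<Rightarrow> int" where
    "h d k = - 24 * d^2 * k - 48 * d * k^2 + 64 * k^3 - 16 * k" for d k
  define Q :: "int \<Rightarrow> int" where "Q d = 48 * odd_part d" for d
  define T :: "int \<Rightarrow> int" where "T d = 24 * odd_part d - 8 * alt_power 1 d - 16 * alt_power 3 d" for d
  have exp: "eis2 * eis2_alt - eis4 =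
      24 * lambert odd_part - 8 * lambert (alt_power 1) - 16 * lambert (alt_power 3)
          - 192 * (lambert odd_part * lambert (alt_power 1))"
    unfolding eis2_def eis2_alt_def eis4_def eis6_def eis8_def by algebra
  show "(2 * (fps_X * fps_deriv eis2)) $ n = (eis2 * eis2_alt - eis4) $ n"
  proof (cases "n = 0")
    case True
    then show ?thesis by (simp add: eis2_def eis2_alt_def eis4_def eis6_def eis8_def lambert_nth)
  next
    case False
    have "(\<Sum>(a, b, x, y)\<in>quads n. K (int a) (int b)) =
        int n * (\<Sum>d | d dvd n. Q (int d)) - (\<Sum>d | d dvd n. T (int d))"
    proof (rule sum_quads_closed_form)
      show "n > 0" using False by simp
      fix a b :: int
      show "p a b = p a (a - b)" "p (- a) (- b) = p a b" "z a b = z a (a - b)" "z a b = z b a"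
        unfolding p_def z_def by (algebra | simp)+
      show "K a b + K b a = 2 * (z a b - z (a + b) b)" if "even a" "even b"
        unfolding K_def z_def odd_part_def alt_power_def by (simp add: that, algebra?)
      show "K a b + K b a = 2 * (p a b - p a (a + b))" if "even a" "odd b"
        unfolding K_def p_def odd_part_def alt_power_def by (simp add: that, algebra?)
      show "K a b + K b a = 2 * (p (a - b) a - p (a + b) b)" if "odd a" "odd b"
        unfolding K_def p_def odd_part_def alt_power_def by (simp add: that, algebra?)
    next
      fix d k :: int
      show "z d d = d * Q d" if "even d"
        unfolding Q_def z_def odd_part_def alt_power_def by (simp add: that, algebra?)
      show "p 0 d = d * Q d" if "odd d"
        unfolding Q_def p_def odd_part_def alt_power_def by (simp add: that, algebra?)
      show "g d 0 = 0" "h d 0 = 0" unfolding g_def h_def by simp_all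
      show "g d (k + 1) = g d k + p (2 * k) d + p (d - (2 * k + 1)) d"
        unfolding g_def p_def by algebra
      show "h d (k + 1) = h d k + z d (2 * k) + p d (2 * k + 1)"
        unfolding h_def p_def z_def by algebra
    next
      fix k :: int
      show "g (2 * k + 1) k + p (2 * k) (2 * k + 1) = T (2 * k + 1)"
        unfolding g_def p_def T_def odd_part_def alt_power_def by (simp, algebra?)
      show "h (2 * k) k + z (2 * k) (2 * k) = T (2 * k) + z (2 * k) 0"
        unfolding h_def z_def T_def odd_part_def alt_power_def by (simp, algebra?)
    qed
    then have "real_of_int (\<Sum>(a, b, x, y)\<in>quads n. K (int a) (int b)) =
        real_of_int (int n * (\<Sum>d | d dvd n. Q (int d)) - (\<Sum>d | d dvd n. T (int d)))"
      by (rule arg_cong)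
    moreover have "real_of_int (\<Sum>(a, b, x, y)\<in>quads n. K (int a) (int b)) =
        - 192 * (lambert odd_part * lambert (alt_power 1)) $ n"
      unfolding lambert_mult_nth K_def case_prod_unfold
      by (simp add: sum.distrib sum_subtractf sum_distrib_left sum_negf)
    moreover have "real_of_int (int n * (\<Sum>d | d dvd n. Q (int d)) - (\<Sum>d | d dvd n. T (int d))) =
        48 * real n * lambert odd_part $ n - (24 * lambert odd_part $ n
            - 8 * lambert (alt_power 1) $ n - 16 * lambert (alt_power 3) $ n)"
      using False by (simp add: lambert_nth Q_def T_def sum.distrib sum_subtractf sum_distrib_left mult_ac)
    ultimately show ?thesis
      unfolding exp using False by (simp add: numeral_mult_fps_nth X_fps_deriv_nth eis2_def eis4_def)
  qed
qed

text \<open>The scheme of \<open>deriv_eis2\<close> one weight higher, with polynomials of degree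
  4.\<close>

lemma deriv_eis4: "fps_X * fps_deriv eis4 = eis4 * eis2_alt - eis6"
proof (rule fps_ext)
  fix n :: nat
  define K :: "int \<Rightarrow> int \<Rightarrow> int" where "K a b = - 128 * (alt_power 3 a * alt_power 1 b)" for a b
  define p :: "int \<Rightarrow> int \<Rightarrow> int" where "p a b = 32 * a^2 * b * (a - b) - 16 * b^2 * (a - b)^2" for a b
  \<comment> \<open>Here \<open>K\<close> does not vanish on even pairs. The form
    \<open>a^2 - a * b + b^2\<close> has both required symmetries, and its square has the degree of
    \<open>K\<close>.\<close>
  define z :: "int \<Rightarrow> int \<Rightarrow> int" where "z a b = 16 * (a^2 - a * b + b^2)^2" for a b
  define g :: "int \<Rightarrow> int \<Rightarrow> int" where
    "g d k = - 16 * d^4 * k - 32 * d^3 * k + 96 * d^2 * k^2 - 48 * d^2 * k - 128 * d * k^3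
        + 96 * d * k^2" for d k
  define h :: "int \<Rightarrow> int \<Rightarrow> int" where
    "h d k = 16 * d^4 * k + 32 * d^3 * k - 96 * d^2 * k^2 + 48 * d^2 * k + 128 * d * k^3
        - 96 * d * k^2 - 128 * k^4 + 128 * k^3 - 16 * k" for d k
  define Q :: "int \<Rightarrow> int" where "Q d = 16 * alt_power 3 d" for d
  define T :: "int \<Rightarrow> int" where "T d = 16 * alt_power 3 d - 8 * alt_power 1 d + 8 * alt_power 5 d" for d
  have exp: "eis4 * eis2_alt - eis6 =
      16 * lambert (alt_power 3) - 8 * lambert (alt_power 1) + 8 * lambert (alt_power 5)
          - 128 * (lambert (alt_power 3) * lambert (alt_power 1))"
    unfolding eis2_def eis2_alt_def eis4_def eis6_def eis8_def by algebra
  show "(fps_X * fps_deriv eis4) $ n = (eis4 * eis2_alt - eis6) $ n"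
  proof (cases "n = 0")
    case True
    then show ?thesis by (simp add: eis2_def eis2_alt_def eis4_def eis6_def eis8_def lambert_nth)
  next
    case False
    have "(\<Sum>(a, b, x, y)\<in>quads n. K (int a) (int b)) =
        int n * (\<Sum>d | d dvd n. Q (int d)) - (\<Sum>d | d dvd n. T (int d))"
    proof (rule sum_quads_closed_form)
      show "n > 0" using False by simp
      fix a b :: int
      show "p a b = p a (a - b)" "p (- a) (- b) = p a b" "z a b = z a (a - b)" "z a b = z b a"
        unfolding p_def z_def by (algebra | simp)+
      show "K a b + K b a = 2 * (z a b - z (a + b) b)" if "even a" "even b"
        unfolding K_def z_def odd_part_def alt_power_def by (simp add: that, algebra?)
      show "K a b + K b a = 2 * (p a b - p a (a + b))" if "even a" "odd b"
        unfolding K_def p_def odd_part_def alt_power_def by (simp add: that, algebra?)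
      show "K a b + K b a = 2 * (p (a - b) a - p (a + b) b)" if "odd a" "odd b"
        unfolding K_def p_def odd_part_def alt_power_def by (simp add: that, algebra?)
    next
      fix d k :: int
      show "z d d = d * Q d" if "even d"
        unfolding Q_def z_def odd_part_def alt_power_def by (simp add: that, algebra?)
      show "p 0 d = d * Q d" if "odd d"
        unfolding Q_def p_def odd_part_def alt_power_def by (simp add: that, algebra?)
      show "g d 0 = 0" "h d 0 = 0" unfolding g_def h_def by simp_all
      show "g d (k + 1) = g d k + p (2 * k) d + p (d - (2 * k + 1)) d"
        unfolding g_def p_def by algebra
      show "h d (k + 1) = h d k + z d (2 * k) + p d (2 * k + 1)"
        unfolding h_def p_def z_def by algebra
    next
      fix k :: int
      show "g (2 * k + 1) k + p (2 * k) (2 * k + 1) = T (2 * k + 1)"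
        unfolding g_def p_def T_def odd_part_def alt_power_def by (simp, algebra?)
      show "h (2 * k) k + z (2 * k) (2 * k) = T (2 * k) + z (2 * k) 0"
        unfolding h_def z_def T_def odd_part_def alt_power_def by (simp, algebra?)
    qed
    then have "real_of_int (\<Sum>(a, b, x, y)\<in>quads n. K (int a) (int b)) =
        real_of_int (int n * (\<Sum>d | d dvd n. Q (int d)) - (\<Sum>d | d dvd n. T (int d)))"
      by (rule arg_cong)
    moreover have "real_of_int (\<Sum>(a, b, x, y)\<in>quads n. K (int a) (int b)) =
        - 128 * (lambert (alt_power 3) * lambert (alt_power 1)) $ n"
      unfolding lambert_mult_nth K_def case_prod_unfold
      by (simp add: sum.distrib sum_subtractf sum_distrib_left sum_negf)
    moreover have "real_of_int (int n * (\<Sum>d | d dvd n. Q (int d)) - (\<Sum>d | d dvd n. T (int d))) =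
        16 * real n * lambert (alt_power 3) $ n - (16 * lambert (alt_power 3) $ n
            - 8 * lambert (alt_power 1) $ n + 8 * lambert (alt_power 5) $ n)"
      using False by (simp add: lambert_nth Q_def T_def sum.distrib sum_subtractf sum_distrib_left mult_ac)
    ultimately show ?thesis
      unfolding exp using False by (simp add: numeral_mult_fps_nth X_fps_deriv_nth eis2_def eis4_def)
  qed
qed

text \<open>There is no derivative, so \<open>Q = 0\<close>: the glued function has to vanish on the
  diagonal, which the factor \<open>a^2\<close> of \<open>p\<close> and \<open>z = 0\<close>
  ensure.\<close>

lemma eis6_eq: "eis2 * eis4 = eis6"
proof (subst eq_iff_diff_eq_0, rule fps_ext)
  fix n :: nat
  define K :: "int \<Rightarrow> int \<Rightarrow> int" where "K a b = 384 * (odd_part a * alt_power 3 b)" for a b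
  define p :: "int \<Rightarrow> int \<Rightarrow> int" where "p a b = 96 * a^2 * b * (a - b)" for a b
  define z :: "int \<Rightarrow> int \<Rightarrow> int" where "z a b = 0" for a b
  define g :: "int \<Rightarrow> int \<Rightarrow> int" where
    "g d k = - 96 * d^3 * k^2 + 128 * d^2 * k^3 + 192 * d^2 * k^2 - 128 * d^2 * k
        - 384 * d * k^3 + 288 * d * k^2" for d k
  define h :: "int \<Rightarrow> int \<Rightarrow> int" where
    "h d k = 96 * d^3 * k^2 - 128 * d^2 * k^3 + 32 * d^2 * k" for d k
  define Q :: "int \<Rightarrow> int" where "Q d = 0" for d
  define T :: "int \<Rightarrow> int" where "T d = 24 * odd_part d + 16 * alt_power 3 d + 8 * alt_power 5 d" for d
  have exp: "eis2 * eis4 - eis6 =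
      24 * lambert odd_part + 16 * lambert (alt_power 3) + 8 * lambert (alt_power 5)
          + 384 * (lambert odd_part * lambert (alt_power 3))"
    unfolding eis2_def eis2_alt_def eis4_def eis6_def eis8_def by algebra
  show "(eis2 * eis4 - eis6) $ n = 0 $ n"
  proof (cases "n = 0")
    case True
    then show ?thesis by (simp add: eis2_def eis2_alt_def eis4_def eis6_def eis8_def lambert_nth)
  next
    case False
    have "(\<Sum>(a, b, x, y)\<in>quads n. K (int a) (int b)) =
        int n * (\<Sum>d | d dvd n. Q (int d)) - (\<Sum>d | d dvd n. T (int d))"
    proof (rule sum_quads_closed_form)
      show "n > 0" using False by simp
      fix a b :: int
      show "p a b = p a (a - b)" "p (- a) (- b) = p a b" "z a b = z a (a - b)" "z a b = z b a"
        unfolding p_def z_def by (algebra | simp)+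
      show "K a b + K b a = 2 * (z a b - z (a + b) b)" if "even a" "even b"
        unfolding K_def z_def odd_part_def alt_power_def by (simp add: that, algebra?)
      show "K a b + K b a = 2 * (p a b - p a (a + b))" if "even a" "odd b"
        unfolding K_def p_def odd_part_def alt_power_def by (simp add: that, algebra?)
      show "K a b + K b a = 2 * (p (a - b) a - p (a + b) b)" if "odd a" "odd b"
        unfolding K_def p_def odd_part_def alt_power_def by (simp add: that, algebra?)
    next
      fix d k :: int
      show "z d d = d * Q d" if "even d"
        unfolding Q_def z_def odd_part_def alt_power_def by (simp add: that, algebra?)
      show "p 0 d = d * Q d" if "odd d"
        unfolding Q_def p_def odd_part_def alt_power_def by (simp add: that, algebra?)
      show "g d 0 = 0" "h d 0 = 0" unfolding g_def h_def by simp_all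
      show "g d (k + 1) = g d k + p (2 * k) d + p (d - (2 * k + 1)) d"
        unfolding g_def p_def by algebra
      show "h d (k + 1) = h d k + z d (2 * k) + p d (2 * k + 1)"
        unfolding h_def p_def z_def by algebra
    next
      fix k :: int
      show "g (2 * k + 1) k + p (2 * k) (2 * k + 1) = T (2 * k + 1)"
        unfolding g_def p_def T_def odd_part_def alt_power_def by (simp, algebra?)
      show "h (2 * k) k + z (2 * k) (2 * k) = T (2 * k) + z (2 * k) 0"
        unfolding h_def z_def T_def odd_part_def alt_power_def by (simp, algebra?)
    qed
    then have "real_of_int (\<Sum>(a, b, x, y)\<in>quads n. K (int a) (int b)) =
        real_of_int (int n * (\<Sum>d | d dvd n. Q (int d)) - (\<Sum>d | d dvd n. T (int d)))"
      by (rule arg_cong)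
    moreover have "real_of_int (\<Sum>(a, b, x, y)\<in>quads n. K (int a) (int b)) =
        384 * (lambert odd_part * lambert (alt_power 3)) $ n"
      unfolding lambert_mult_nth K_def case_prod_unfold
      by (simp add: sum.distrib sum_subtractf sum_distrib_left sum_negf)
    moreover have "real_of_int (int n * (\<Sum>d | d dvd n. Q (int d)) - (\<Sum>d | d dvd n. T (int d))) =
        0 - (24 * lambert odd_part $ n + 16 * lambert (alt_power 3) $ n
            + 8 * lambert (alt_power 5) $ n)"
      using False by (simp add: lambert_nth Q_def T_def sum.distrib sum_subtractf sum_distrib_left mult_ac)
    ultimately show ?thesis
      unfolding exp using False by (simp add: numeral_mult_fps_nth X_fps_deriv_nth eis2_def eis4_def)
  qed
qed

text \<open>The weights 9 and 8 are forced by degrees 0 and 1: \<open>9 + 8 = 17\<close> and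
  \<open>9 * (- 32) + 8 * 32 = - 32\<close>. Again \<open>Q = 0\<close>, as \<open>p\<close> and
  \<open>z\<close> vanish on the diagonal.\<close>

lemma eis8_eq_eis2_eis4_eis6: "9 * (eis4 * eis4) + 8 * (eis2 * eis6) = eis8"
proof (subst eq_iff_diff_eq_0, rule fps_ext)
  fix n :: nat
  define K :: "int \<Rightarrow> int \<Rightarrow> int" where "K a b = 2304 * (alt_power 3 a * alt_power 3 b) - 1536 * (odd_part a * alt_power 5 b)" for a b
  define p :: "int \<Rightarrow> int \<Rightarrow> int" where "p a b = 576 * a^2 * b^2 * (a - b)^2 - 384 * a^4 * b * (a - b)" for a b
  define z :: "int \<Rightarrow> int \<Rightarrow> int" where "z a b = - 576 * a^2 * b^2 * (a - b)^2" for a b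
  define g :: "int \<Rightarrow> int \<Rightarrow> int" where
    "g d k = 384 * d^5 * k^2 - 512 * d^4 * k^3 - 1152 * d^4 * k^2 + 704 * d^4 * k
        + 4608 * d^3 * k^3 - 3456 * d^3 * k^2 - 7680 * d^2 * k^4 + 7680 * d^2 * k^3
        - 960 * d^2 * k + 6144 * d * k^5 - 7680 * d * k^4 + 1920 * d * k^2" for d k
  define h :: "int \<Rightarrow> int \<Rightarrow> int" where
    "h d k = - 384 * d^5 * k^2 + 512 * d^4 * k^3 + 1152 * d^4 * k^2 - 704 * d^4 * k
        - 4608 * d^3 * k^3 + 3456 * d^3 * k^2 + 4608 * d^2 * k^4 - 4608 * d^2 * k^3
        + 576 * d^2 * k" for d k
  define Q :: "int \<Rightarrow> int" where "Q d = 0" for d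
  define T :: "int \<Rightarrow> int" where "T d = 288 * alt_power 3 d + 192 * odd_part d - 64 * alt_power 5 d - 32 * alt_power 7 d" for d
  have exp: "9 * (eis4 * eis4) + 8 * (eis2 * eis6) - eis8 =
      288 * lambert (alt_power 3) + 192 * lambert odd_part - 64 * lambert (alt_power 5)
          - 32 * lambert (alt_power 7) + 2304 * (lambert (alt_power 3) * lambert (alt_power 3))
          - 1536 * (lambert odd_part * lambert (alt_power 5))"
    unfolding eis2_def eis2_alt_def eis4_def eis6_def eis8_def by algebra
  show "(9 * (eis4 * eis4) + 8 * (eis2 * eis6) - eis8) $ n = 0 $ n"
  proof (cases "n = 0")
    case True
    then show ?thesis by (simp add: eis2_def eis2_alt_def eis4_def eis6_def eis8_def lambert_nth)
  next
    case False
    have "(\<Sum>(a, b, x, y)\<in>quads n. K (int a) (int b)) =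
        int n * (\<Sum>d | d dvd n. Q (int d)) - (\<Sum>d | d dvd n. T (int d))"
    proof (rule sum_quads_closed_form)
      show "n > 0" using False by simp
      fix a b :: int
      show "p a b = p a (a - b)" "p (- a) (- b) = p a b" "z a b = z a (a - b)" "z a b = z b a"
        unfolding p_def z_def by (algebra | simp)+
      show "K a b + K b a = 2 * (z a b - z (a + b) b)" if "even a" "even b"
        unfolding K_def z_def odd_part_def alt_power_def by (simp add: that, algebra?)
      show "K a b + K b a = 2 * (p a b - p a (a + b))" if "even a" "odd b"
        unfolding K_def p_def odd_part_def alt_power_def by (simp add: that, algebra?)
      show "K a b + K b a = 2 * (p (a - b) a - p (a + b) b)" if "odd a" "odd b"
        unfolding K_def p_def odd_part_def alt_power_def by (simp add: that, algebra?)
    next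
      fix d k :: int
      show "z d d = d * Q d" if "even d"
        unfolding Q_def z_def odd_part_def alt_power_def by (simp add: that, algebra?)
      show "p 0 d = d * Q d" if "odd d"
        unfolding Q_def p_def odd_part_def alt_power_def by (simp add: that, algebra?)
      show "g d 0 = 0" "h d 0 = 0" unfolding g_def h_def by simp_all
      show "g d (k + 1) = g d k + p (2 * k) d + p (d - (2 * k + 1)) d"
        unfolding g_def p_def by algebra
      show "h d (k + 1) = h d k + z d (2 * k) + p d (2 * k + 1)"
        unfolding h_def p_def z_def by algebra
    next
      fix k :: int
      show "g (2 * k + 1) k + p (2 * k) (2 * k + 1) = T (2 * k + 1)"
        unfolding g_def p_def T_def odd_part_def alt_power_def by (simp, algebra?)
      show "h (2 * k) k + z (2 * k) (2 * k) = T (2 * k) + z (2 * k) 0"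
        unfolding h_def z_def T_def odd_part_def alt_power_def by (simp, algebra?)
    qed
    then have "real_of_int (\<Sum>(a, b, x, y)\<in>quads n. K (int a) (int b)) =
        real_of_int (int n * (\<Sum>d | d dvd n. Q (int d)) - (\<Sum>d | d dvd n. T (int d)))"
      by (rule arg_cong)
    moreover have "real_of_int (\<Sum>(a, b, x, y)\<in>quads n. K (int a) (int b)) =
        2304 * (lambert (alt_power 3) * lambert (alt_power 3)) $ n
            - 1536 * (lambert odd_part * lambert (alt_power 5)) $ n"
      unfolding lambert_mult_nth K_def case_prod_unfold
      by (simp add: sum.distrib sum_subtractf sum_distrib_left sum_negf)
    moreover have "real_of_int (int n * (\<Sum>d | d dvd n. Q (int d)) - (\<Sum>d | d dvd n. T (int d))) =
        0 - (288 * lambert (alt_power 3) $ n + 192 * lambert odd_part $ n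
            - 64 * lambert (alt_power 5) $ n - 32 * lambert (alt_power 7) $ n)"
      using False by (simp add: lambert_nth Q_def T_def sum.distrib sum_subtractf sum_distrib_left mult_ac)
    ultimately show ?thesis
      unfolding exp using False by (simp add: numeral_mult_fps_nth X_fps_deriv_nth eis2_def eis4_def)
  qed
qed

subsection \<open>Logarithmic derivatives and the products of Gauss\<close>

text \<open>Stated without division so that it also covers series with zero constant term, such as
  \<open>fps_X * psi ^ 8\<close>.\<close>

definition log_deriv :: "real fps \<Rightarrow> real fps \<Rightarrow> bool" where
  "log_deriv f w \<longleftrightarrow> fps_X * fps_deriv f = f * w"

lemma log_deriv_mult: "log_deriv f v \<Longrightarrow> log_deriv g w \<Longrightarrow> log_deriv (f * g) (v + w)"
  unfolding log_deriv_def fps_deriv_mult by algebra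

lemma log_deriv_1: "log_deriv 1 0"
  by (simp add: log_deriv_def)

lemma log_deriv_power: "log_deriv f w \<Longrightarrow> log_deriv (f ^ k) (of_nat k * w)"
  by (induction k) (auto simp: log_deriv_1 distrib_right dest: log_deriv_mult)

lemma log_deriv_prod:
  assumes "\<And>k. k \<in> S \<Longrightarrow> log_deriv (f k) (w k)"
  shows "log_deriv (\<Prod>k\<in>S. f k) (\<Sum>k\<in>S. w k)"
  using assms by (induction S rule: infinite_finite_induct) (simp_all add: log_deriv_1 log_deriv_mult)

lemma log_deriv_cancel:
  assumes "log_deriv (f * g) (v + w)" "log_deriv g w" "g \<noteq> 0"
  shows "log_deriv f v"
proof -
  have "g * (fps_X * fps_deriv f) = g * (f * v)"
    using assms(1,2) unfolding log_deriv_def fps_deriv_mult by algebra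
  then show ?thesis using assms(3) by (simp add: log_deriv_def)
qed

lemma log_deriv_fps_X: "log_deriv fps_X 1"
  by (simp add: log_deriv_def)

text \<open>Degree \<open>n\<close> of the equation determines \<open>(n - k)\<close> times the
  coefficient of \<open>f\<close> from the earlier coefficients. It fails to determine the
  coefficient at \<open>n = k\<close>, hence the agreement required up to \<open>k\<close>.\<close>

lemma log_deriv_unique:
  assumes f: "log_deriv f w" and g: "log_deriv g w" and w: "w $ 0 = real k"
    and eq: "\<And>i. i \<le> k \<Longrightarrow> f $ i = g $ i"
  shows "f = g"
proof (rule fps_ext)
  have rec: "(real n - real k) * f $ n = (\<Sum>i<n. f $ i * w $ (n - i))" if "log_deriv f w" for f n
  proof -
    have "real n * f $ n = (fps_X * fps_deriv f) $ n" by (rule X_fps_deriv_nth[symmetric])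
    also have "\<dots> = (\<Sum>i=0..n. f $ i * w $ (n - i))"
      using that by (simp only: log_deriv_def fps_mult_nth)
    also have "\<dots> = (\<Sum>i<n. f $ i * w $ (n - i)) + f $ n * real k"
      using w by (simp add: atLeast0AtMost lessThan_Suc_atMost[symmetric])
    finally show ?thesis by (simp add: algebra_simps)
  qed
  show "f $ n = g $ n" for n
  proof (induction n rule: less_induct)
    case (less n)
    show ?case
    proof (cases "n \<le> k")
      case False
      have "(real n - real k) * f $ n = (real n - real k) * g $ n"
        unfolding rec[OF f] rec[OF g] using less by simp
      then show ?thesis using False by simp
    qed (rule eq)
  qed
qed

text \<open>Degree \<open>n\<close> of the defining equation involves only coefficients up to
  \<open>n\<close>, so partial products can replace an infinite product.\<close>

lemma log_deriv_limit:
  assumes "\<And>n. \<exists>g v. log_deriv g v \<and> (\<forall>m\<le>n. f $ m = g $ m) \<and> (\<forall>m\<le>n. w $ m = v $ m)"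
  shows "log_deriv f w"
  unfolding log_deriv_def
proof (rule fps_ext)
  fix n
  obtain g v where gv: "log_deriv g v" "\<forall>m\<le>n. f $ m = g $ m" "\<forall>m\<le>n. w $ m = v $ m"
    using assms by blast
  have "(fps_X * fps_deriv f) $ n = (fps_X * fps_deriv g) $ n"
    using gv(2) by (simp only: X_fps_deriv_nth)
  also have "\<dots> = (g * v) $ n" using gv(1) by (simp add: log_deriv_def)
  also have "\<dots> = (f * w) $ n" unfolding fps_mult_nth using gv by (intro sum.cong) auto
  finally show "(fps_X * fps_deriv f) $ n = (f * w) $ n" .
qed

text \<open>The expansion of \<open>X^k / (1 - X^k)\<close>, the building block of Lambert
  series.\<close>

definition geom :: "nat \<Rightarrow> real fps" where
  "geom k = Abs_fps (\<lambda>m. if 0 < m \<and> k dvd m then 1 else 0)"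

lemma geom_mult:
  assumes "k > 0"
  shows "(1 - fps_X ^ k) * geom k = fps_X ^ k"
proof (rule fps_ext)
  fix m
  have "k dvd m - k \<longleftrightarrow> k dvd m" if "k \<le> m" using that by (simp add: dvd_minus_self)
  then show "((1 - fps_X ^ k) * geom k) $ m = (fps_X ^ k) $ m"
    using assms by (auto simp: algebra_simps fps_X_power_mult_right_nth fps_X_power_mult_nth geom_def dest: dvd_imp_le)
qed

lemma log_deriv_one_minus:
  assumes "k > 0"
  shows "log_deriv (1 - fps_X ^ k) (- of_nat k * geom k)"
proof -
  have "fps_X * fps_deriv (1 - fps_X ^ k) = - of_nat k * (fps_X ^ k :: real fps)"
    by (rule fps_ext, subst X_fps_deriv_nth) (simp flip: fps_of_nat)
  also have "\<dots> = (1 - fps_X ^ k) * (- of_nat k * geom k)"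
    using geom_mult[OF assms] by (metis mult.left_commute)
  finally show ?thesis by (simp add: log_deriv_def)
qed

lemma one_minus_X_power_nonzero: "k > 0 \<Longrightarrow> (1 - fps_X ^ k :: real fps) \<noteq> 0"
  by (metis fps_X_power_nth fps_one_nth fps_sub_nth fps_zero_nth diff_zero less_irrefl zero_neq_one)

text \<open>Divide \<open>1 - X^(2k)\<close> by \<open>1 - X^k\<close>.\<close>

lemma log_deriv_one_plus:
  assumes "k > 0"
  shows "log_deriv (1 + fps_X ^ k) (of_nat k * geom k - of_nat (2 * k) * geom (2 * k))"
proof (rule log_deriv_cancel)
  show "log_deriv ((1 + fps_X ^ k) * (1 - fps_X ^ k))
     (of_nat k * geom k - of_nat (2 * k) * geom (2 * k) + - of_nat k * geom k)"
    using log_deriv_one_minus[of "2 * k"] assms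
    by (simp add: algebra_simps flip: power_add mult_2)
qed (use assms log_deriv_one_minus one_minus_X_power_nonzero in auto)

lemma log_deriv_inverse:
  assumes "log_deriv f w" "f $ 0 \<noteq> 0"
  shows "log_deriv (inverse f) (- w)"
proof (rule log_deriv_cancel)
  show "log_deriv (inverse f * f) (- w + w)" using assms by (simp add: inverse_mult_eq_1 log_deriv_1)
qed (use assms in auto)

text \<open>Shanks' finite forms of Gauss' two product identities: modulo a power of \<open>fps_X\<close> that grows
  with \<open>n\<close>, only the term \<open>s = 0\<close> survives, and it is a partial product. In the step from \<open>n\<close> to
  \<open>Suc n\<close> the change of the sum over \<open>s \<le> m\<close> telescopes to \<open>C m\<close>.\<close>

definition phi_factor :: "nat \<Rightarrow> real fps" where
  "phi_factor k = (1 - fps_X ^ Suc k) * inverse (1 + fps_X ^ Suc k)"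

text \<open>The factor \<open>2 * inverse (1 + fps_X ^ s)\<close> is \<open>1\<close> at
  \<open>s = 0\<close>, so that term is the bare partial product.\<close>

definition phi_tail :: "nat \<Rightarrow> nat \<Rightarrow> real fps" where
  "phi_tail n s = (-1) ^ s * (2 * inverse (1 + fps_X ^ s)) * (\<Prod>k = s..<n. phi_factor k) * fps_X ^ (s * Suc n)"

lemma inverse_one_plus_X_power: "inverse (1 + fps_X ^ k) * (1 + fps_X ^ k) = (1 :: real fps)"
  by (rule inverse_mult_eq_1) (cases k, simp_all)

lemma phi_finite_identity:
  "(\<Sum>s\<le>n. phi_tail n s) = 1 + 2 * (\<Sum>s=1..n. (-1) ^ s * fps_X ^ (s\<^sup>2))"
proof (induction n)
  case 0
  have "inverse (1 + fps_X ^ 0) * (1 + fps_X ^ 0) = (1 :: real fps)" by (rule inverse_one_plus_X_power)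
  then show ?case by (simp add: phi_tail_def mult.commute)
next
  case (Suc n)
  define C :: "nat \<Rightarrow> real fps" where
    "C s = - ((-1) ^ s * 2 * (\<Prod>k = s..<n. phi_factor k) * fps_X ^ (Suc s * Suc n)
       * inverse (1 + fps_X ^ Suc n))" for s
  \<comment> \<open>The third summand is \<open>C (s - 1)\<close> for \<open>s > 0\<close> and
    vanishes for \<open>s = 0\<close>; thus the change of term \<open>s\<close> is a difference of
    consecutive values of \<open>C\<close>.\<close>
  have key: "phi_tail (Suc n) s - phi_tail n s +
     (-1) ^ s * 2 * (1 - fps_X ^ s) * inverse (1 + fps_X ^ s) * (\<Prod>k = s..<n. phi_factor k)
       * fps_X ^ (s * Suc n) * inverse (1 + fps_X ^ Suc n) = C s" if "s \<le> n" for s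
  proof -
    define I where "I = inverse (1 + fps_X ^ Suc n :: real fps)"
    define J where "J = inverse (1 + fps_X ^ s :: real fps)"
    define u where "u = (fps_X ^ s :: real fps)"
    define v where "v = (fps_X ^ Suc n :: real fps)"
    define t where "t = (fps_X ^ (s * Suc n) :: real fps)"
    define \<rho> where "\<rho> = (\<Prod>k = s..<n. phi_factor k)"
    define e where "e = ((-1) ^ s :: real fps)"
    have I: "I * (1 + v) = 1" unfolding I_def v_def by (rule inverse_one_plus_X_power)
    have J: "J * (1 + u) = 1" unfolding J_def u_def by (rule inverse_one_plus_X_power)
    have t1: "fps_X ^ (s * Suc (Suc n)) = t * u" and t2: "fps_X ^ (Suc s * Suc n) = t * v"
      unfolding t_def u_def v_def by (simp_all add: algebra_simps flip: power_add)
    have "(\<Prod>k = s..<Suc n. phi_factor k) = \<rho> * ((1 - v) * I)"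
      using that by (simp add: \<rho>_def v_def I_def phi_factor_def)
    then have A: "phi_tail (Suc n) s = e * (2 * J) * (\<rho> * ((1 - v) * I)) * (t * u)"
      unfolding phi_tail_def t1 by (simp add: e_def J_def u_def)
    have B: "phi_tail n s = e * (2 * J) * \<rho> * t"
      unfolding phi_tail_def by (simp add: e_def J_def u_def t_def \<rho>_def)
    have "e * (2 * J) * (\<rho> * ((1 - v) * I)) * (t * u) - e * (2 * J) * \<rho> * t
       + e * 2 * (1 - u) * J * \<rho> * t * I = - (e * 2 * \<rho> * (t * v) * I)"
      using I J by algebra
    then show ?thesis
      unfolding A B C_def t2
      by (simp only: e_def J_def u_def t_def \<rho>_def I_def v_def)
  qed
  have tele: "(\<Sum>s\<le>m. phi_tail (Suc n) s - phi_tail n s) = C m" if "m \<le> n" for m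
    using that
  proof (induction m)
    case 0
    then show ?case using key[of 0] by simp
  next
    case (Suc m)
    have "(\<Prod>k = m..<n. phi_factor k) = phi_factor m * (\<Prod>k = Suc m..<n. phi_factor k)"
      using Suc.prems by (simp add: prod.atLeast_Suc_lessThan)
    then have "C m = (-1) ^ Suc m * 2 * (1 - fps_X ^ Suc m) * inverse (1 + fps_X ^ Suc m)
        * (\<Prod>k = Suc m..<n. phi_factor k) * fps_X ^ (Suc m * Suc n) * inverse (1 + fps_X ^ Suc n)"
      unfolding C_def by (simp add: phi_factor_def mult_ac)
    then show ?case using Suc.IH Suc.prems key[of "Suc m"] by simp
  qed
  \<comment> \<open>What is left of the telescoping sum and the new top term
    \<open>s = Suc n\<close> combine to the new square term on the right.\<close>
  have "C n + phi_tail (Suc n) (Suc n) = 2 * ((-1) ^ Suc n * fps_X ^ ((Suc n)\<^sup>2))"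
  proof -
    define I where "I = inverse (1 + fps_X ^ Suc n :: real fps)"
    define v where "v = (fps_X ^ Suc n :: real fps)"
    define t where "t = (fps_X ^ ((Suc n)\<^sup>2) :: real fps)"
    define e where "e = ((-1) ^ n :: real fps)"
    have I: "I * (1 + v) = 1" unfolding I_def v_def by (rule inverse_one_plus_X_power)
    have t1: "fps_X ^ (Suc n * Suc (Suc n)) = t * v" and t2: "fps_X ^ (Suc n * Suc n) = t"
      unfolding t_def v_def by (simp_all add: power2_eq_square algebra_simps flip: power_add)
    have C: "C n = - (e * 2 * t * I)" unfolding C_def t2 by (simp add: e_def I_def)
    have A: "phi_tail (Suc n) (Suc n) = - (e * (2 * I) * (t * v))"
      unfolding phi_tail_def t1 by (simp add: e_def I_def)
    have "- (e * 2 * t * I) - e * (2 * I) * (t * v) = - (2 * (e * t))" using I by algebra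
    then show ?thesis unfolding C A by (simp add: e_def t_def)
  qed
  moreover have "(\<Sum>s\<le>Suc n. phi_tail (Suc n) s) =
      (\<Sum>s\<le>n. phi_tail n s) + (C n + phi_tail (Suc n) (Suc n))"
    using tele[of n] by (simp add: sum_subtractf algebra_simps)
  ultimately show ?case unfolding Suc.IH by (simp add: distrib_left)
qed

definition psi_factor :: "nat \<Rightarrow> real fps" where
  "psi_factor k = (1 - fps_X ^ (2 * k + 2)) * inverse (1 - fps_X ^ (2 * k + 1))"

definition psi_tail :: "nat \<Rightarrow> nat \<Rightarrow> real fps" where
  "psi_tail n s = (\<Prod>k = s..<n. psi_factor k) * fps_X ^ (s * (2 * n + 1))"

lemma inverse_one_minus_X_power: "k > 0 \<Longrightarrow> inverse (1 - fps_X ^ k) * (1 - fps_X ^ k) = (1 :: real fps)"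
  by (rule inverse_mult_eq_1) simp

lemma psi_finite_identity:
  "(\<Sum>s\<le>n. psi_tail n s) = (\<Sum>s\<le>2 * n. fps_X ^ (s * (s + 1) div 2))"
proof (induction n)
  case 0
  show ?case by (simp add: psi_tail_def)
next
  case (Suc n)
  define I where "I = inverse (1 - fps_X ^ (2 * n + 1) :: real fps)"
  define w where "w = (fps_X ^ (2 * n + 1) :: real fps)"
  have I: "I * (1 - w) = 1" unfolding I_def w_def by (rule inverse_one_minus_X_power) simp
  define C :: "nat \<Rightarrow> real fps" where
    "C s = (\<Prod>k = s..<n. psi_factor k) * (1 - fps_X ^ (2 * s + 1)) * fps_X ^ (Suc s * (2 * n + 1)) * I" for s
  \<comment> \<open>As before, the third summand is \<open>C (s - 1)\<close>, and zero for
    \<open>s = 0\<close>.\<close>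
  have key: "psi_tail (Suc n) s - psi_tail n s +
     (\<Prod>k = s..<n. psi_factor k) * (1 - fps_X ^ (2 * s)) * fps_X ^ (s * (2 * n + 1)) * I = C s"
    if "s \<le> n" for s
  proof -
    define u where "u = (fps_X ^ (2 * s) :: real fps)"
    define t where "t = (fps_X ^ (s * (2 * n + 1)) :: real fps)"
    define \<rho> where "\<rho> = (\<Prod>k = s..<n. psi_factor k)"
    have e: "fps_X ^ (s * (2 * Suc n + 1)) = t * u" "fps_X ^ (Suc s * (2 * n + 1)) = t * w"
      "fps_X ^ (2 * n + 2) = w * fps_X" "fps_X ^ (2 * s + 1) = u * fps_X"
      unfolding t_def u_def w_def by (simp_all add: algebra_simps flip: power_add)
    have A: "psi_tail (Suc n) s = \<rho> * ((1 - w * fps_X) * I) * (t * u)"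
      using that unfolding psi_tail_def e(1) by (simp add: \<rho>_def psi_factor_def I_def flip: e(3))
    have "\<rho> * ((1 - w * fps_X) * I) * (t * u) - \<rho> * t + \<rho> * (1 - u) * t * I
        = \<rho> * (1 - u * fps_X) * (t * w) * I"
      using I by algebra
    then show ?thesis
      unfolding A C_def e unfolding psi_tail_def by (simp only: u_def t_def \<rho>_def)
  qed
  have tele: "(\<Sum>s\<le>m. psi_tail (Suc n) s - psi_tail n s) = C m" if "m \<le> n" for m
    using that
  proof (induction m)
    case 0
    then show ?case using key[of 0] by simp
  next
    case (Suc m)
    have "(\<Prod>k = m..<n. psi_factor k) = psi_factor m * (\<Prod>k = Suc m..<n. psi_factor k)"
      using Suc.prems by (simp add: prod.atLeast_Suc_lessThan)
    then have "C m = (inverse (1 - fps_X ^ (2 * m + 1)) * (1 - fps_X ^ (2 * m + 1))) *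
        ((\<Prod>k = Suc m..<n. psi_factor k) * (1 - fps_X ^ (2 * Suc m)) * fps_X ^ (Suc m * (2 * n + 1)) * I)"
      unfolding C_def by (simp add: psi_factor_def mult_ac)
    then have "C m = (\<Prod>k = Suc m..<n. psi_factor k) * (1 - fps_X ^ (2 * Suc m)) * fps_X ^ (Suc m * (2 * n + 1)) * I"
      by (subst (asm) inverse_one_minus_X_power) simp_all
    then have "C m + (psi_tail (Suc n) (Suc m) - psi_tail n (Suc m)) = C (Suc m)"
      using key[OF Suc.prems] by (simp only: add.commute)
    then show ?case using Suc.IH Suc.prems by simp
  qed
  have "C n = fps_X ^ (Suc n * (2 * n + 1)) * (I * (1 - w))"
    by (simp add: C_def w_def mult_ac)
  then have C: "C n = fps_X ^ (Suc n * (2 * n + 1))" using I by simp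
  \<comment> \<open>Each step adds two triangular exponents: \<open>C n\<close> supplies the one of
    index \<open>2 * n + 1\<close>, the new top term that of index \<open>2 * n + 2\<close>.\<close>
  have e1: "(2 * n + 1) * (2 * n + 1 + 1) div 2 = Suc n * (2 * n + 1)"
    and e2: "(2 * n + 2) * (2 * n + 2 + 1) div 2 = Suc n * (2 * Suc n + 1)"
  proof -
    have "(2 * n + 1) * (2 * n + 1 + 1) = 2 * (Suc n * (2 * n + 1))" by (simp add: algebra_simps)
    then show "(2 * n + 1) * (2 * n + 1 + 1) div 2 = Suc n * (2 * n + 1)" by simp
    have "(2 * n + 2) * (2 * n + 2 + 1) = 2 * (Suc n * (2 * Suc n + 1))" by (simp add: algebra_simps)
    then show "(2 * n + 2) * (2 * n + 2 + 1) div 2 = Suc n * (2 * Suc n + 1)" by simp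
  qed
  have "(\<Sum>s\<le>2 * Suc n. fps_X ^ (s * (s + 1) div 2)) = (\<Sum>s\<le>2 * n. fps_X ^ (s * (s + 1) div 2))
      + fps_X ^ ((2 * n + 1) * (2 * n + 1 + 1) div 2) + (fps_X ^ ((2 * n + 2) * (2 * n + 2 + 1) div 2) :: real fps)"
  proof -
    have "2 * Suc n = Suc (Suc (2 * n))" by simp
    then show ?thesis by (simp only: sum.atMost_Suc) simp
  qed
  also have "\<dots> = (\<Sum>s\<le>n. psi_tail n s) + C n + psi_tail (Suc n) (Suc n)"
    unfolding e1 e2 C Suc.IH by (simp add: psi_tail_def)
  also have "\<dots> = (\<Sum>s\<le>Suc n. psi_tail (Suc n) s)"
    using tele[of n] by (simp add: sum_subtractf algebra_simps)
  finally show ?case by simp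
qed

subsection \<open>Theta series\<close>

text \<open>Splitting off the head of a list matches the Cauchy product. Finiteness is proved along
  the way since the cardinalities need it. The sign \<open>c\<close> is \<open>-1\<close> for
  \<open>phi_neg\<close> and \<open>1\<close> for \<open>psi\<close>, whence the
  \<open>1 ^ n\<close> there.\<close>

lemma fps_power_nth_count_lists:
  fixes w :: "'a \<Rightarrow> nat" and c :: real
  assumes fin: "\<And>n. finite {x. w x = n}"
  shows "finite {xs. length xs = s \<and> sum_list (map w xs) = n} \<and>
    (Abs_fps (\<lambda>n. c ^ n * real (card {x. w x = n})) ^ s) $ n =
      c ^ n * real (card {xs. length xs = s \<and> sum_list (map w xs) = n})"
proof (induction s arbitrary: n)
  case 0
  have "{xs. length xs = 0 \<and> sum_list (map w xs) = n} = (if n = 0 then {[]} else {})" by auto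
  then show ?case by simp
next
  case (Suc s)
  let ?L = "\<lambda>s n. {xs. length xs = s \<and> sum_list (map w xs) = n}"
  let ?P = "\<lambda>i. {x. w x = i} \<times> ?L s (n - i)"
  have eq: "?L (Suc s) n = (\<lambda>(x, xs). x # xs) ` (\<Union>i\<in>{0..n}. ?P i)"
  proof (intro equalityI subsetI)
    fix ys assume "ys \<in> ?L (Suc s) n"
    then obtain x xs where "ys = x # xs" "length xs = s" "w x + sum_list (map w xs) = n"
      by (cases ys) auto
    then show "ys \<in> (\<lambda>(x, xs). x # xs) ` (\<Union>i\<in>{0..n}. ?P i)"
      by (intro image_eqI[of _ _ "(x, xs)"]) auto
  qed auto
  have finP: "finite (?P i)" for i using fin Suc by simp
  have inj: "inj_on (\<lambda>(x, xs). x # xs) A" for A :: "('a \<times> 'a list) set"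
    by (auto simp: inj_on_def)
  have "card (?L (Suc s) n) = card (\<Union>i\<in>{0..n}. ?P i)"
    unfolding eq by (rule card_image[OF inj])
  also have "\<dots> = (\<Sum>i=0..n. card (?P i))"
    using finP by (intro card_UN_disjoint) auto
  finally have card: "card (?L (Suc s) n) = (\<Sum>i=0..n. card {x. w x = i} * card (?L s (n - i)))"
    by (simp add: card_cartesian_product)
  have "(Abs_fps (\<lambda>n. c ^ n * real (card {x. w x = n})) ^ Suc s) $ n =
     (\<Sum>i=0..n. c ^ i * real (card {x. w x = i}) * (c ^ (n - i) * real (card (?L s (n - i)))))"
    using Suc.IH by (simp add: fps_mult_nth)
  also have "\<dots> = (\<Sum>i=0..n. c ^ n * (real (card {x. w x = i}) * real (card (?L s (n - i)))))"
  proof (rule sum.cong)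
    fix i assume "i \<in> {0..n}"
    then have "c ^ n = c ^ i * c ^ (n - i)" by (simp flip: power_add)
    then show "c ^ i * real (card {x. w x = i}) * (c ^ (n - i) * real (card (?L s (n - i)))) =
       c ^ n * (real (card {x. w x = i}) * real (card (?L s (n - i))))" by simp
  qed simp
  also have "\<dots> = c ^ n * real (card (?L (Suc s) n))"
    unfolding card by (simp add: sum_distrib_left)
  finally show ?case using eq finP by simp
qed

definition phi_neg :: "real fps" where
  "phi_neg = Abs_fps (\<lambda>n. (-1) ^ n * real (card {x :: int. nat (x\<^sup>2) = n}))"

definition psi :: "real fps" where
  "psi = Abs_fps (\<lambda>n. 1 ^ n * real (card {t :: nat. t * (t + 1) div 2 = n}))"

lemma nat_square_fibre: "{x :: int. nat (x\<^sup>2) = k\<^sup>2} = {int k, - int k}"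
proof -
  have "nat (x\<^sup>2) = k\<^sup>2 \<longleftrightarrow> x\<^sup>2 = (int k)\<^sup>2" for x :: int
    by (metis nat_int of_nat_power zero_le_power2 int_nat_eq)
  then show ?thesis by (auto simp: power2_eq_iff)
qed

lemma nat_square_fibre_empty:
  assumes "\<And>k. n \<noteq> k\<^sup>2"
  shows "{x :: int. nat (x\<^sup>2) = n} = {}"
proof -
  have "nat (x\<^sup>2) = (nat \<bar>x\<bar>)\<^sup>2" for x :: int
    by (metis nat_power_eq abs_ge_zero power2_abs)
  then show ?thesis using assms by auto
qed

lemma finite_nat_square_fibre: "finite {x :: int. nat (x\<^sup>2) = n}"
  using nat_square_fibre nat_square_fibre_empty by (metis finite.simps)

lemma le_triangular: "t \<le> t * (t + 1) div 2" for t :: nat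
  by (cases t) auto

lemma finite_triangular_fibre: "finite {t :: nat. t * (t + 1) div 2 = n}"
  by (rule finite_subset[of _ "{..n}"]) (use le_triangular in auto)

lemma phi_neg_power_nth: "(phi_neg ^ s) $ n = (-1) ^ n * real (r_squares s n)"
proof -
  have "int (sum_list (map (\<lambda>x :: int. nat (x\<^sup>2)) m)) = (\<Sum>x\<leftarrow>m. x\<^sup>2)" for m
    by (induction m) auto
  then have "{m :: int list. length m = s \<and> sum_list (map (\<lambda>x. nat (x\<^sup>2)) m) = n} = square_reps s n"
    unfolding square_reps_def by (metis of_nat_eq_iff)
  then show ?thesis
    using fps_power_nth_count_lists[of "\<lambda>x :: int. nat (x\<^sup>2)" s n "-1", OF finite_nat_square_fibre]
    by (simp add: phi_neg_def r_squares_def)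
qed

lemma psi_power_8_nth: "(psi ^ 8) $ n = real (delta8 n)"
  using fps_power_nth_count_lists[of "\<lambda>t :: nat. t * (t + 1) div 2" 8 n 1, OF finite_triangular_fibre]
  by (simp add: psi_def delta8_def triangular_reps_def)

text \<open>A square \<open>k^2 <= n\<close> has \<open>k <= n\<close>; the roots \<open>k\<close>
  and \<open>- k\<close> give the factor 2, and \<open>k^2\<close> has the parity of
  \<open>k\<close>.\<close>

lemma phi_neg_nth_partial:
  assumes "m \<le> n"
  shows "phi_neg $ m = (1 + 2 * (\<Sum>s=1..n. (-1) ^ s * fps_X ^ (s\<^sup>2))) $ m"
proof -
  have sgn: "((-1) ^ s :: real fps) = fps_const ((-1) ^ s)" for s
    by (induction s) (simp_all flip: fps_const_neg)
  have rhs: "(1 + 2 * (\<Sum>s=1..n. (-1) ^ s * fps_X ^ (s\<^sup>2))) $ m =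
     (if m = 0 then 1 else 0) + 2 * (\<Sum>s=1..n. if m = s\<^sup>2 then (-1) ^ s else 0 :: real)"
    by (simp add: numeral_mult_fps_nth fps_sum_nth sgn if_distrib cong: if_cong)
  show ?thesis
  proof (cases "\<exists>k. m = k\<^sup>2")
    case True
    then obtain k where k: "m = k\<^sup>2" by blast
    have "k \<le> m" unfolding k by (cases k) (simp_all add: power2_eq_square)
    have "(\<Sum>s=1..n. if m = s\<^sup>2 then (-1) ^ s else 0 :: real) = (\<Sum>s=1..n. if s = k then (-1) ^ k else 0)"
      unfolding k by (intro sum.cong) auto
    also have "\<dots> = (if k = 0 then 0 else (-1) ^ k)"
      using \<open>k \<le> m\<close> assms by (simp add: sum.delta)
    finally have *: "(\<Sum>s=1..n. if m = s\<^sup>2 then (-1) ^ s else 0 :: real) = (if k = 0 then 0 else (-1) ^ k)" .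
    have "((-1) :: real) ^ k\<^sup>2 = (-1) ^ k" by (cases "even k") simp_all
    moreover have "card {int k, - int k} = (if k = 0 then 1 else 2)" by simp
    ultimately show ?thesis unfolding rhs * by (simp add: phi_neg_def k nat_square_fibre)
  next
    case False
    then have "m \<noteq> k\<^sup>2" for k by blast
    moreover from this[of 0] have "m \<noteq> 0" by simp
    ultimately show ?thesis unfolding rhs by (simp add: phi_neg_def nat_square_fibre_empty)
  qed
qed

lemma psi_nth_partial:
  assumes "m \<le> 2 * n"
  shows "psi $ m = (\<Sum>s\<le>2 * n. fps_X ^ (s * (s + 1) div 2)) $ m"
proof -
  have "{t :: nat. t * (t + 1) div 2 = m} = {t \<in> {..2 * n}. m = t * (t + 1) div 2}"
    using assms le_triangular by (auto intro: order_trans)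
  then show ?thesis
    by (simp add: psi_def fps_sum_nth sum.If_cases Int_def)
qed

text \<open>All divisors of \<open>m\<close> lie in \<open>1..n\<close>, so truncating at
  \<open>n\<close> loses nothing in degree \<open>m\<close>.\<close>

lemma sum_geom_nth:
  assumes "0 < m" "m \<le> n"
  shows "(\<Sum>k<n. c (Suc k) * geom (Suc k) $ m) = (\<Sum>d | d dvd m. c d)"
proof -
  have "(\<Sum>k<n. c (Suc k) * geom (Suc k) $ m) = (\<Sum>d\<in>{1..n}. c d * geom d $ m)"
    by (rule sum.reindex_bij_witness[where i = "\<lambda>d. d - 1" and j = Suc]) auto
  also have "\<dots> = (\<Sum>d | d dvd m. c d * geom d $ m)"
  proof (intro sum.mono_neutral_right)
    show "{d. d dvd m} \<subseteq> {1..n}"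
    proof
      fix d assume "d \<in> {d. d dvd m}"
      then have "d dvd m" by simp
      then have "d > 0" "d \<le> m" using assms by (auto intro: dvd_pos_nat dvd_imp_le)
      then show "d \<in> {1..n}" using assms by simp
    qed
  qed (auto simp: geom_def)
  also have "\<dots> = (\<Sum>d | d dvd m. c d)"
    using assms by (simp add: geom_def)
  finally show ?thesis .
qed

lemma of_nat_mult_fps_nth: "(of_nat k * f) $ n = real k * (f $ n :: real)"
  by (simp flip: fps_of_nat)

text \<open>Gauss' product of \<open>(1 - X^d) / (1 + X^d)\<close> contributes \<open>- 2 d\<close>
  for every divisor \<open>d\<close> and \<open>d\<close> again for every even one: in total
  \<open>- 2 d\<close> for odd \<open>d\<close> and \<open>- d\<close> for even
  \<open>d\<close>.\<close>

lemma log_deriv_phi_neg: "log_deriv phi_neg (- lambert (alt_power 1) - 3 * lambert odd_part)"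
proof (rule log_deriv_limit)
  fix n
  define v where "v = (\<Sum>k<n. - of_nat (Suc k) * geom (Suc k)
      + - (of_nat (Suc k) * geom (Suc k) - of_nat (2 * Suc k) * geom (2 * Suc k)))"
  have "log_deriv (\<Prod>k<n. phi_factor k) v"
    unfolding v_def phi_factor_def
    by (intro log_deriv_prod log_deriv_mult log_deriv_inverse log_deriv_one_minus log_deriv_one_plus) simp_all
  moreover have "phi_neg $ m = (\<Prod>k<n. phi_factor k) $ m" if "m \<le> n" for m
  proof -
    have "phi_neg $ m = (\<Sum>s\<le>n. phi_tail n s) $ m"
      unfolding phi_finite_identity by (rule phi_neg_nth_partial[OF that])
    also have "\<dots> = (\<Sum>s\<in>{0}. phi_tail n s $ m)"
      unfolding fps_sum_nth
    proof (intro sum.mono_neutral_right ballI)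
      fix s assume "s \<in> {..n} - {0}"
      \<comment> \<open>Terms with \<open>s > 0\<close> start in degree at least
        \<open>Suc n\<close>, beyond \<open>m\<close>.\<close>
      then have "1 * Suc n \<le> s * Suc n" by (intro mult_right_mono) auto
      then have "m < s * Suc n" using that by simp
      then show "phi_tail n s $ m = 0"
        by (simp add: phi_tail_def fps_X_power_mult_right_nth del: mult_Suc_right)
    qed auto
    also have "\<dots> = (\<Prod>k<n. phi_factor k) $ m"
    proof -
      have "2 * inverse (1 + fps_X ^ 0) = (1 :: real fps)"
        using inverse_one_plus_X_power[of 0] by (simp add: mult.commute)
      then have "phi_tail n 0 = (\<Prod>k<n. phi_factor k)"
        by (simp only: phi_tail_def power_0 mult_0 mult_1 mult_1_right lessThan_atLeast0)
      then show ?thesis by simp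
    qed
    finally show ?thesis .
  qed
  moreover have "(- lambert (alt_power 1) - 3 * lambert odd_part) $ m = v $ m" if "m \<le> n" for m
  proof (cases "m = 0")
    case True
    then show ?thesis
      by (simp add: v_def fps_sum_nth lambert_nth geom_def numeral_mult_fps_nth)
  next
    case False
    have "v $ m = - 2 * (\<Sum>k<n. real (Suc k) * geom (Suc k) $ m)
        + (\<Sum>k<n. real (2 * Suc k) * geom (2 * Suc k) $ m)"
      unfolding v_def fps_sum_nth sum_distrib_left sum.distrib[symmetric]
      by (intro sum.cong refl) (simp only: fps_add_nth fps_neg_nth fps_sub_nth mult_minus_left of_nat_mult_fps_nth)
    also have "(\<Sum>k<n. real (Suc k) * geom (Suc k) $ m) = (\<Sum>d | d dvd m. real d)"
      using False that by (intro sum_geom_nth) auto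
    also have "(\<Sum>k<n. real (2 * Suc k) * geom (2 * Suc k) $ m) = (\<Sum>d | d dvd m. if even d then real d else 0)"
    proof -
      have "(\<Sum>k<n. real (2 * Suc k) * geom (2 * Suc k) $ m) =
          (\<Sum>d\<in>{d \<in> {..2 * n}. even d \<and> 0 < d}. real d * geom d $ m)"
        by (rule sum.reindex_bij_witness[where i = "\<lambda>d. d div 2 - 1" and j = "\<lambda>k. 2 * Suc k"]) (auto elim!: evenE)
      also have "\<dots> = (\<Sum>d | d dvd m \<and> even d. real d * geom d $ m)"
        using False that
        by (intro sum.mono_neutral_right) (auto simp: geom_def dest: dvd_imp_le intro: dvd_pos_nat)
      also have "\<dots> = (\<Sum>d | d dvd m \<and> even d. real d)"
        using False by (intro sum.cong) (auto simp: geom_def)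
      also have "\<dots> = (\<Sum>d | d dvd m. if even d then real d else 0)"
        using False by (simp add: sum.If_cases Int_def)
      finally show ?thesis .
    qed
    also have "- 2 * (\<Sum>d | d dvd m. real d) + (\<Sum>d | d dvd m. if even d then real d else 0) =
       (\<Sum>d | d dvd m. - real_of_int (alt_power 1 (int d)) - 3 * real_of_int (odd_part (int d)))"
      unfolding sum_distrib_left sum.distrib[symmetric]
      by (intro sum.cong) (auto simp: alt_power_def odd_part_def)
    also have "\<dots> = (- lambert (alt_power 1) - 3 * lambert odd_part) $ m"
      using False by (simp add: lambert_nth numeral_mult_fps_nth sum_subtractf sum_negf sum_distrib_left)
    finally show ?thesis by simp
  qed
  ultimately show "\<exists>g v. log_deriv g v \<and> (\<forall>m\<le>n. phi_neg $ m = g $ m) \<and>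
      (\<forall>m\<le>n. (- lambert (alt_power 1) - 3 * lambert odd_part) $ m = v $ m)"
    by blast
qed

text \<open>In Gauss' product for \<open>psi\<close> the factors \<open>1 - X^d\<close> stand in the
  numerator for even \<open>d\<close> and in the denominator for odd \<open>d\<close>.\<close>

lemma log_deriv_psi: "log_deriv psi (- lambert (alt_power 1))"
proof (rule log_deriv_limit)
  fix n
  define v where "v = (\<Sum>k<n. - of_nat (2 * k + 2) * geom (2 * k + 2)
      + - (- of_nat (2 * k + 1) * geom (2 * k + 1)))"
  have "log_deriv (\<Prod>k<n. psi_factor k) v"
    unfolding v_def psi_factor_def
    by (intro log_deriv_prod log_deriv_mult log_deriv_inverse log_deriv_one_minus) simp_all
  moreover have "psi $ m = (\<Prod>k<n. psi_factor k) $ m" if "m \<le> n" for m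
  proof -
    have "psi $ m = (\<Sum>s\<le>n. psi_tail n s) $ m"
      unfolding psi_finite_identity using that by (intro psi_nth_partial) simp
    also have "\<dots> = (\<Sum>s\<in>{0}. psi_tail n s $ m)"
      unfolding fps_sum_nth
    proof (intro sum.mono_neutral_right ballI)
      fix s assume "s \<in> {..n} - {0}"
      then have "1 * (2 * n + 1) \<le> s * (2 * n + 1)" by (intro mult_right_mono) auto
      then have "m < s * (2 * n + 1)" using that by simp
      then show "psi_tail n s $ m = 0" by (simp add: psi_tail_def fps_X_power_mult_right_nth)
    qed auto
    also have "\<dots> = (\<Prod>k<n. psi_factor k) $ m"
      by (simp add: psi_tail_def lessThan_atLeast0)
    finally show ?thesis .
  qed
  moreover have "(- lambert (alt_power 1)) $ m = v $ m" if "m \<le> n" for m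
  proof (cases "m = 0")
    case True
    then show ?thesis by (simp add: v_def fps_sum_nth lambert_nth geom_def)
  next
    case False
    \<comment> \<open>The indices \<open>2 * k + 1\<close> and \<open>2 * k + 2\<close> with
      \<open>k < n\<close> interleave to \<open>1..2 * n\<close>.\<close>
    have "v $ m = (\<Sum>k<2 * n. - real_of_int (alt_power 1 (int (Suc k))) * geom (Suc k) $ m)"
      unfolding v_def fps_sum_nth
      by (induction n) (simp_all add: of_nat_mult_fps_nth numeral_mult_fps_nth alt_power_def algebra_simps)
    also have "\<dots> = (\<Sum>d | d dvd m. - real_of_int (alt_power 1 (int d)))"
      using False that sum_geom_nth[of m "2 * n" "\<lambda>d. - real_of_int (alt_power 1 (int d))"] by simp
    finally show ?thesis using False by (simp add: lambert_nth sum_negf)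
  qed
  ultimately show "\<exists>g v. log_deriv g v \<and> (\<forall>m\<le>n. psi $ m = g $ m) \<and>
      (\<forall>m\<le>n. (- lambert (alt_power 1)) $ m = v $ m)"
    by blast
qed

lemma phi_neg_nth_0: "phi_neg $ 0 = 1" and psi_nth_0: "psi $ 0 = 1"
  using phi_neg_nth_partial[of 0 0] psi_nth_partial[of 0 0] by simp_all

text \<open>Jacobi's eight-square theorem. In the notation of the overview both sides have
  logarithmic derivative \<open>V - e\<close>, because \<open>D a = a V - e a\<close>; its constant
  term is 0, so comparing constant terms suffices.\<close>

lemma phi_neg_power_8: "phi_neg ^ 8 = eis4"
proof (rule log_deriv_unique)
  have "of_nat 8 * (- lambert (alt_power 1) - 3 * lambert odd_part) = eis2_alt - eis2"
    unfolding eis2_alt_def eis2_def by simp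
  then show "log_deriv (phi_neg ^ 8) (eis2_alt - eis2)"
    using log_deriv_power[OF log_deriv_phi_neg, of 8] by simp
  show "log_deriv eis4 (eis2_alt - eis2)"
    unfolding log_deriv_def using deriv_eis4 eis6_eq by algebra
  show "(eis2_alt - eis2) $ 0 = real 0" by (simp add: eis2_alt_def eis2_def lambert_nth)
  show "(phi_neg ^ 8) $ i = eis4 $ i" if "i \<le> 0" for i
    using that by (simp add: phi_neg_nth_0 fps_power_zeroth eis4_def lambert_nth)
qed

text \<open>\<open>D (e^2 - a) = e (e V - a) - (a V - e a) = (e^2 - a) V\<close>. As
  \<open>V\<close> has constant term 1, degrees 0 and 1 are compared; the factor is
  \<open>64 = 48 + 16\<close>.\<close>

lemma psi_power_8: "64 * (fps_X * psi ^ 8) = eis2 * eis2 - eis4"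
proof (rule log_deriv_unique)
  have "log_deriv (fps_X * psi ^ 8) (1 + of_nat 8 * (- lambert (alt_power 1)))"
    by (intro log_deriv_mult log_deriv_power log_deriv_fps_X log_deriv_psi)
  then have "log_deriv (fps_X * psi ^ 8) eis2_alt" by (simp add: eis2_alt_def)
  then show "log_deriv (64 * (fps_X * psi ^ 8)) eis2_alt"
    using log_deriv_mult[of 64 0 "fps_X * psi ^ 8" eis2_alt] by (simp add: log_deriv_def)
  show "log_deriv (eis2 * eis2 - eis4) eis2_alt"
  proof -
    have "fps_deriv (eis2 * eis2 - eis4) = 2 * (eis2 * fps_deriv eis2) - fps_deriv eis4"
      by (simp add: algebra_simps)
    then show ?thesis
      unfolding log_deriv_def using deriv_eis2 deriv_eis4 eis6_eq by algebra
  qed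
  show "eis2_alt $ 0 = real 1" by (simp add: eis2_alt_def lambert_nth)
  show "(64 * (fps_X * psi ^ 8)) $ i = (eis2 * eis2 - eis4) $ i" if "i \<le> 1" for i
  proof (cases "i = 0")
    case True
    then show ?thesis by (simp add: eis2_def eis4_def lambert_nth)
  next
    case False
    then have "i = Suc 0" using that by simp
    then show ?thesis
      by (simp add: numeral_mult_fps_nth psi_nth_0 fps_power_zeroth eis2_def eis4_def lambert_nth
          odd_part_def alt_power_def)
  qed
qed

section \<open>The generating function identity and its coefficients\<close>

lemma eis8_eq: "eis8 = 17 * phi_neg ^ 16 + 512 * (eis4 * (fps_X * psi ^ 8))"
proof -
  have "phi_neg ^ 16 = eis4 * eis4"
    by (simp flip: phi_neg_power_8 power_add)
  \<comment> \<open>\<open>9 a^2 + 8 e b = 9 a^2 + 8 e^2 a = 17 a^2 + 8 a (e^2 - a)\<close>, and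
    \<open>8 * 64 = 512\<close>.\<close>
  then show ?thesis using eis8_eq_eis2_eis4_eis6 eis6_eq psi_power_8 by algebra
qed

lemma lambert_alt_power_nth: "0 < n \<Longrightarrow> lambert (alt_power k) $ n = - real_of_int (sigma_star k n)"
proof -
  have "alt_power k (int d) = (-1) ^ d * int d ^ k" for d
    by (simp add: alt_power_def)
  then show "0 < n \<Longrightarrow> ?thesis" by (simp add: lambert_nth sigma_star_def)
qed

text \<open>The convention \<open>- 1 / 16\<close> at 0 is what extends the formula to the constant
  term 1.\<close>

lemma eis4_nth: "eis4 $ n = - 16 * sigma3_star n"
  by (cases "n = 0")
     (simp_all add: eis4_def lambert_alt_power_nth sigma3_star_def numeral_mult_fps_nth, simp add: lambert_nth)

theorem theorem4p15:
  fixes n :: nat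
  assumes "n \<ge> 1"
  shows "real (r_squares 16 n) =
    (-1) ^ n * (32 / 17) *
      (256 * (\<Sum>j = 0..n - 1. sigma3_star j * real (delta8 (n - j - 1)))
        - real_of_int (sigma_star 7 n))"
proof -
  let ?S = "\<Sum>j = 0..n - 1. sigma3_star j * real (delta8 (n - j - 1))"
  have "(eis4 * (fps_X * psi ^ 8)) $ n = (\<Sum>j=0..n. eis4 $ j * (fps_X * psi ^ 8) $ (n - j))"
    by (rule fps_mult_nth)
  \<comment> \<open>The term \<open>j = n\<close> drops out because \<open>fps_X * psi ^ 8\<close>
    has zero constant term; for \<open>j < n\<close> the factor \<open>fps_X\<close> shifts the
    index to \<open>n - j - 1\<close>.\<close>
  also have "\<dots> = (\<Sum>j=0..n - 1. eis4 $ j * (fps_X * psi ^ 8) $ (n - j))"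
    by (rule sum.mono_neutral_right) auto
  also have "\<dots> = (\<Sum>j=0..n - 1. - 16 * (sigma3_star j * real (delta8 (n - j - 1))))"
    using assms by (intro sum.cong) (auto simp: eis4_nth psi_power_8_nth)
  finally have prod: "(eis4 * (fps_X * psi ^ 8)) $ n = - 16 * ?S"
    by (simp only: sum_distrib_left)
  have "eis8 $ n = 17 * (phi_neg ^ 16) $ n + 512 * (eis4 * (fps_X * psi ^ 8)) $ n"
    unfolding eis8_eq by (simp only: fps_add_nth numeral_mult_fps_nth)
  moreover have "eis8 $ n = - 32 * real_of_int (sigma_star 7 n)"
    using assms by (simp add: eis8_def fps_numeral_nth numeral_mult_fps_nth lambert_alt_power_nth)
  ultimately have "17 * ((-1) ^ n * real (r_squares 16 n)) = 8192 * ?S - 32 * real_of_int (sigma_star 7 n)"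
    unfolding prod phi_neg_power_nth by simp
  then have "(-1) ^ n * real (r_squares 16 n) = 32 / 17 * (256 * ?S - real_of_int (sigma_star 7 n))"
    by simp
  \<comment> \<open>The sign from \<open>phi(-q)\<close> is its own inverse and moves to the other
    side.\<close>
  then have "(-1) ^ n * ((-1) ^ n * real (r_squares 16 n)) =
      (-1) ^ n * (32 / 17 * (256 * ?S - real_of_int (sigma_star 7 n)))"
    by (rule arg_cong)
  moreover have "(-1) ^ n * ((-1) ^ n * x) = x" for x :: real
    by (cases "even n") simp_all
  ultimately show ?thesis by (simp only: mult.assoc)
qed

end
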